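(* Let $(\Omega,\mathscr H,\widehat{\mathbb E})$ be a sub-linear expectation space with a sequence of independent and identically distributed random variables $\{X_n;n\ge1\}$, and let $\mathbb V$ be a sub-additive capacity on $\mathcal F$ satisfying the compatibility property (C). Consider the subspace $$\widetilde{\mathscr H}=\left\{Y=\varphi(X_1,X_2,\dots,X_n):\ \varphi\in C_{l,Lip}(\mathbb R^n),\ \widehat{\mathbb E}[(|Y|-c)^+]\to0\text{ as }c\to\infty,\ n\ge1\right\}.$$ If $\mathbb V$ is continuous on $\sigma(X_1,X_2,\dots)$, then $\widehat{\mathbb E}$ is linear on $\widetilde{\mathscr H}$.
   Context: Sub-linear expectation space: $(\Omega,\mathcal F)$ is a measurable space and $\mathscr H$ is a linear space of real measurable functions on it such that $\varphi(X_1,\dots,X_n)\in\mathscr H$ whenever $X_1,\dots,X_n\in\mathscr H$ and $\varphi\in C_{l,Lip}(\mathbb R^n)$, where $C_{l,Lip}(\mathbb R^n)$ is the set of $\varphi$ with $|\varphi(x)-\varphi(y)|\le C(1+|x|^m+|y|^m)|x-y|$ for some $C>0$, $m\in\mathbb N$ depending on $\varphi$. A sub-linear expectation is a map $\widehat{\mathbb E}:\mathscr H\to[-\infty,\infty]$ such that: $X\ge Y$ implies $\widehat{\mathbb E}[X]\ge\widehat{\mathbb E}[Y]$; $\widehat{\mathbb E}[c]=c$ for constants $c$; $\widehat{\mathbb E}[X+Y]\le\widehat{\mathbb E}[X]+\widehat{\mathbb E}[Y]$ whenever the right side is not of the form $\infty-\infty$; $\widehat{\mathbb E}[\lambda X]=\lambda\widehat{\mathbb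 E}[X]$ for $\lambda\ge0$ (with $0\cdot\infty=0$). Elements of $\mathscr H$ are called random variables. Independence: a random vector $\bm Y\in\mathscr H^n$ is independent to $\bm X\in\mathscr H^m$ if $\widehat{\mathbb E}[\varphi(\bm X,\bm Y)]=\widehat{\mathbb E}\big[\widehat{\mathbb E}[\varphi(\bm x,\bm Y)]|_{\bm x=\bm X}\big]$ for each $\varphi\in C_{l,Lip}(\mathbb R^m\times\mathbb R^n)$ with $\overline\varphi(\bm x):=\widehat{\mathbb E}[|\varphi(\bm x,\bm Y)|]<\infty$ for all $\bm x$ and $\widehat{\mathbb E}[|\overline\varphi(\bm X)|]<\infty$. A sequence $\{X_n\}$ is independent if $X_{i+1}$ is independent to $(X_1,\dots,X_i)$ for each $i\ge1$; it is identically distributed if $\widehat{\mathbb E}[\varphi(X_i)]=\widehat{\mathbb E}[\varphi(X_1)]$ for all bounded Lipschitz $\varphi$ and all $i$. Capacities: a capacity is a monotone set function $V:\mathcal F\to[0,1]$ with $V(\emptyset)=0$, $V(\Omega)=1$; it is sub-additive if $V(A\cup B)\le V(A)+V(B)$. Property (C) for $\mathbb V$: $\widehat{\mathbb E}[f]\le\mathbb V(A)\le\widehat{\mathbb E}[g]$ whenever $f\le I_A\le g$, $f,g\in\mathscr H$, $A\in\mathcal F$. A sub-additive capacity is called continuous if it is continuous from above, i.e. $V(A_n)\downarrow V(A)$ whenever $A_n\downarrow A$ (this, with sub-additivity, implies continuity from below: $V(A_n)\uparrow V(A)$ whenever $A_n\uparrow A$); "on $\sigma(X_1,X_2,\dots)$"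 means for events in that $\sigma$-field. *)

theory Defs
  imports "HOL-Analysis.Analysis"
begin

(* Points of R^n are represented by sequences nat => real of which only the entries with index
   below n matter; random vectors are sequences of random variables, read in the same way.
   All indices start at 0, so X 0 is the first member of a sequence of random variables. *)

definition vnorm :: "nat \<Rightarrow> (nat \<Rightarrow> real) \<Rightarrow> real" where
  "vnorm n x = sqrt (\<Sum>i<n. (x i)\<^sup>2)"

(* The increment bound forces a member to depend on the first n entries only (C_l_Lip_cong below),
   so this is exactly the class of locally Lipschitz functions of polynomial growth on R^n. *)
definition C_l_Lip :: "nat \<Rightarrow> ((nat \<Rightarrow> real) \<Rightarrow> real) set" where
  "C_l_Lip n = {\<phi>. \<exists>C>0. \<exists>m::nat. \<forall>x y.
     \<bar>\<phi> x - \<phi> y\<bar> \<le> C * (1 + vnorm n x ^ m + vnorm n y ^ m) * vnorm n (\<lambda>i. x i - y i)}"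

lemma C_l_Lip_cong:
  assumes "\<phi> \<in> C_l_Lip n" and "\<And>i. i < n \<Longrightarrow> x i = y i"
  shows "\<phi> x = \<phi> y"
proof -
  obtain C and m :: nat where
    "\<bar>\<phi> x - \<phi> y\<bar> \<le> C * (1 + vnorm n x ^ m + vnorm n y ^ m) * vnorm n (\<lambda>i. x i - y i)"
    using assms(1) unfolding C_l_Lip_def by blast
  moreover have "vnorm n (\<lambda>i. x i - y i) = 0"
    using assms(2) by (simp add: vnorm_def)
  ultimately show ?thesis by simp
qed

definition linear_space :: "('a \<Rightarrow> real) set \<Rightarrow> bool" where
  "linear_space S \<longleftrightarrow> (\<lambda>_. 0) \<in> S \<and>
     (\<forall>X\<in>S. \<forall>Y\<in>S. (\<lambda>\<omega>. X \<omega> + Y \<omega>) \<in> S) \<and>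
     (\<forall>X\<in>S. \<forall>c. (\<lambda>\<omega>. c * X \<omega>) \<in> S)"

(* The functional E is meaningful on H only; its values outside H are unspecified.
   Monotonicity makes E X depend only on the restriction of X to space M. *)
locale sublinear_expectation_space =
  fixes M :: "'a measure"
    and H :: "('a \<Rightarrow> real) set"
    and E :: "('a \<Rightarrow> real) \<Rightarrow> ereal"
  assumes H_measurable: "H \<subseteq> borel_measurable M"
    and H_linear: "linear_space H"
    and H_closed: "\<And>n \<phi> X. n \<ge> 1 \<Longrightarrow> \<phi> \<in> C_l_Lip n \<Longrightarrow> (\<And>i. i < n \<Longrightarrow> X i \<in> H)
          \<Longrightarrow> (\<lambda>\<omega>. \<phi> (\<lambda>i. X i \<omega>)) \<in> H"
    and E_mono: "\<And>X Y. X \<in> H \<Longrightarrow> Y \<in> H \<Longrightarrow> (\<And>\<omega>. \<omega> \<in> space M \<Longrightarrow> Y \<omega> \<le> X \<omega>) \<Longrightarrow> E Y \<le> E X"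
    and E_const: "\<And>c. E (\<lambda>_. c) = ereal c"
    and E_subadd: "\<And>X Y. X \<in> H \<Longrightarrow> Y \<in> H
          \<Longrightarrow> \<not> (E X = \<infinity> \<and> E Y = -\<infinity>) \<Longrightarrow> \<not> (E X = -\<infinity> \<and> E Y = \<infinity>)
          \<Longrightarrow> E (\<lambda>\<omega>. X \<omega> + Y \<omega>) \<le> E X + E Y"
    and E_scale: "\<And>X c. X \<in> H \<Longrightarrow> c \<ge> 0 \<Longrightarrow> E (\<lambda>\<omega>. c * X \<omega>) = ereal c * E X"

definition vjoin :: "nat \<Rightarrow> (nat \<Rightarrow> real) \<Rightarrow> (nat \<Rightarrow> real) \<Rightarrow> nat \<Rightarrow> real" where
  "vjoin m x y i = (if i < m then x i else y (i - m))"

(* The n-dimensional random vector Y is independent to the m-dimensional random vector X.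
   The defining identity applies E to the variables obtained by substituting X for x in
   E |phi(x, Y)| and in E (phi(x, Y)).  E is defined on H only, so the identity is required
   precisely for those phi for which both variables lie in H (with phi bounded Lipschitz
   this is automatic).  Under the first guard both quantities are finite for every x,
   hence real_of_ereal loses nothing. *)
definition independent_to ::
  "('a \<Rightarrow> real) set \<Rightarrow> (('a \<Rightarrow> real) \<Rightarrow> ereal) \<Rightarrow> nat \<Rightarrow> (nat \<Rightarrow> 'a \<Rightarrow> real) \<Rightarrow> nat \<Rightarrow> (nat \<Rightarrow> 'a \<Rightarrow> real) \<Rightarrow> bool"
  where
  "independent_to H E n Y m X \<longleftrightarrow>
     (\<forall>\<phi>\<in>C_l_Lip (m + n).
        let abs_mean = (\<lambda>x. E (\<lambda>\<omega>. \<bar>\<phi> (vjoin m x (\<lambda>i. Y i \<omega>))\<bar>));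
            mean = (\<lambda>x. E (\<lambda>\<omega>. \<phi> (vjoin m x (\<lambda>i. Y i \<omega>))));
            abs_mean_X = (\<lambda>\<omega>. real_of_ereal (abs_mean (\<lambda>i. X i \<omega>)));
            mean_X = (\<lambda>\<omega>. real_of_ereal (mean (\<lambda>i. X i \<omega>)))
        in (\<forall>x. abs_mean x < \<infinity>) \<longrightarrow> abs_mean_X \<in> H \<longrightarrow> E (\<lambda>\<omega>. \<bar>abs_mean_X \<omega>\<bar>) < \<infinity> \<longrightarrow> mean_X \<in> H \<longrightarrow>
           E (\<lambda>\<omega>. \<phi> (vjoin m (\<lambda>i. X i \<omega>) (\<lambda>i. Y i \<omega>))) = E mean_X)"

(* For i >= 1, the variable X i is the successor of the i-dimensional vector (X 0, ..., X (i-1)). *)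
definition independent_seq ::
  "('a \<Rightarrow> real) set \<Rightarrow> (('a \<Rightarrow> real) \<Rightarrow> ereal) \<Rightarrow> (nat \<Rightarrow> 'a \<Rightarrow> real) \<Rightarrow> bool" where
  "independent_seq H E X \<longleftrightarrow> (\<forall>i\<ge>1. independent_to H E 1 (\<lambda>_. X i) i X)"

definition identically_distributed ::
  "(('a \<Rightarrow> real) \<Rightarrow> ereal) \<Rightarrow> (nat \<Rightarrow> 'a \<Rightarrow> real) \<Rightarrow> bool" where
  "identically_distributed E X \<longleftrightarrow>
     (\<forall>\<phi> :: real \<Rightarrow> real. bounded (range \<phi>) \<longrightarrow> (\<exists>L. L-lipschitz_on UNIV \<phi>) \<longrightarrow>
        (\<forall>i. E (\<lambda>\<omega>. \<phi> (X i \<omega>)) = E (\<lambda>\<omega>. \<phi> (X 0 \<omega>))))"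

locale capacity =
  fixes M :: "'a measure" and V :: "'a set \<Rightarrow> real"
  assumes range: "\<And>A. A \<in> sets M \<Longrightarrow> 0 \<le> V A \<and> V A \<le> 1"
    and mono: "\<And>A B. A \<in> sets M \<Longrightarrow> B \<in> sets M \<Longrightarrow> A \<subseteq> B \<Longrightarrow> V A \<le> V B"
    and empty: "V {} = 0"
    and whole: "V (space M) = 1"

locale subadditive_capacity = capacity +
  assumes subadditive: "\<And>A B. A \<in> sets M \<Longrightarrow> B \<in> sets M \<Longrightarrow> V (A \<union> B) \<le> V A + V B"

definition property_C ::
  "'a measure \<Rightarrow> ('a \<Rightarrow> real) set \<Rightarrow> (('a \<Rightarrow> real) \<Rightarrow> ereal) \<Rightarrow> ('a set \<Rightarrow> real) \<Rightarrow> bool" where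
  "property_C M H E V \<longleftrightarrow>
     (\<forall>A\<in>sets M. \<forall>f\<in>H. \<forall>g\<in>H.
        (\<forall>\<omega>\<in>space M. f \<omega> \<le> indicator A \<omega> \<and> indicator A \<omega> \<le> g \<omega>) \<longrightarrow>
        E f \<le> ereal (V A) \<and> ereal (V A) \<le> E g)"

definition sigma_gen :: "'a measure \<Rightarrow> (nat \<Rightarrow> 'a \<Rightarrow> real) \<Rightarrow> 'a set set" where
  "sigma_gen M X = sigma_sets (space M) (\<Union>i. {X i -` B \<inter> space M |B. B \<in> sets borel})"

definition continuous_capacity_on :: "'a set set \<Rightarrow> ('a set \<Rightarrow> real) \<Rightarrow> bool" where
  "continuous_capacity_on G V \<longleftrightarrow>
     (\<forall>A :: nat \<Rightarrow> 'a set. range A \<subseteq> G \<longrightarrow> decseq A \<longrightarrow> (\<lambda>n. V (A n)) \<longlonglongrightarrow> V (\<Inter>n. A n))"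

definition H_tilde ::
  "(('a \<Rightarrow> real) \<Rightarrow> ereal) \<Rightarrow> (nat \<Rightarrow> 'a \<Rightarrow> real) \<Rightarrow> ('a \<Rightarrow> real) set" where
  "H_tilde E X = {Y. \<exists>n\<ge>1. \<exists>\<phi>\<in>C_l_Lip n. Y = (\<lambda>\<omega>. \<phi> (\<lambda>i. X i \<omega>)) \<and>
     ((\<lambda>c::real. E (\<lambda>\<omega>. max (\<bar>Y \<omega>\<bar> - c) 0)) \<longlongrightarrow> 0) at_top}"

(* A (real-valued) linear functional on the linear space S. *)
definition linear_functional_on ::
  "('a \<Rightarrow> real) set \<Rightarrow> (('a \<Rightarrow> real) \<Rightarrow> ereal) \<Rightarrow> bool" where
  "linear_functional_on S E \<longleftrightarrow> linear_space S \<and>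
     (\<forall>Y\<in>S. \<bar>E Y\<bar> \<noteq> \<infinity>) \<and>
     (\<forall>Y\<in>S. \<forall>Z\<in>S. E (\<lambda>\<omega>. Y \<omega> + Z \<omega>) = E Y + E Z) \<and>
     (\<forall>Y\<in>S. \<forall>c. E (\<lambda>\<omega>. c * Y \<omega>) = ereal c * E Y)"

end

(* Write mean for the upper mean E and call - E(- Y) the lower mean of Y. For a bounded Lipschitz
   function Y of X_1, a second-moment estimate shows that the average over a long block of the
   sequence is close to the upper mean with capacity near 1, and likewise, applied to - Y, close to
   the lower mean; by independence such estimates multiply over successive blocks. If the two means
   differ, then over blocks of geometrically growing length the first k averages can be kept near
   the lower mean and a later one brought near the upper mean with capacity at least 1/2. These
   events decrease to the empty set as k grows, contradicting continuity. So both means agree for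
   bounded Lipschitz functions of one variable, by conditioning on the past also of n variables.
   Continuity makes (X_1, ..., X_n) tight, so clipping and cutting off extend this to H_tilde,
   where a sub-linear functional with E(- Y) = - E(Y) is linear. *)

theory Submission
  imports Defs
begin

subsection \<open>Polynomially growing and bounded Lipschitz functions\<close>

text \<open>Independence is only ever applied to bounded Lipschitz test functions: freezing the past
  and taking the mean over the next variable gives a bounded Lipschitz function again, so every
  guard in \<open>independent_to\<close> is met. All estimates are lower bounds for upper means.
  Property (C) turns the upper mean of a function below an indicator into a lower bound for the
  capacity of that event, and lower bounds are what survives when a cross term has a mean of known
  sign only. Indicators of events are therefore replaced by Lipschitz bumps that dominate the
  Chebyshev minorant \<open>1 - (S / (n \<epsilon>))^2\<close> of a block sum \<open>S\<close>, and
  a weight depending on the past is carried along so that blocks can be chained. A block may be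
  steered to the upper or to the lower mean at the same price, a factor
  \<open>1 - 1 / (4 * 2 ^ j)\<close> for block \<open>j\<close>. The geometric lengths make these
  losses summable, so the product of the factors never falls below 1/2; any positive bound would
  give the contradiction.\<close>

lemma vnorm_L2_set: "vnorm n x = L2_set x {..<n}"
  by (simp add: vnorm_def L2_set_def)

lemma vnorm_nonneg [simp]: "0 \<le> vnorm n x"
  by (simp add: vnorm_L2_set)

lemma vnorm_mono: "n \<le> k \<Longrightarrow> vnorm n x \<le> vnorm k x"
  unfolding vnorm_def by (intro real_sqrt_le_mono sum_mono2) auto

lemma abs_le_vnorm: "i < n \<Longrightarrow> \<bar>x i\<bar> \<le> vnorm n x"
  using member_le_L2_set[of "{..<n}" i "\<lambda>i. \<bar>x i\<bar>"] by (simp add: vnorm_def L2_set_def)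

lemma vnorm_triangle: "vnorm n (\<lambda>i. x i + y i) \<le> vnorm n x + vnorm n y"
  by (simp add: vnorm_L2_set L2_set_triangle_ineq)

lemma vnorm_minus_commute: "vnorm n (\<lambda>i. x i - y i) = vnorm n (\<lambda>i. y i - x i)"
  by (simp add: vnorm_def power2_commute)

lemma vnorm_diff: "\<bar>vnorm n x - vnorm n y\<bar> \<le> vnorm n (\<lambda>i. x i - y i)"
  using vnorm_triangle[of n "\<lambda>i. x i - y i" y] vnorm_triangle[of n "\<lambda>i. y i - x i" x]
    vnorm_minus_commute[of n x y] by simp

lemma vnorm_vjoin_left:
  "vnorm (m + k) (\<lambda>i. vjoin m x z i - vjoin m y z i) = vnorm m (\<lambda>i. x i - y i)"
proof -
  have "(\<Sum>i<m + k. (vjoin m x z i - vjoin m y z i)\<^sup>2) = (\<Sum>i<m. (x i - y i)\<^sup>2)"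
    by (intro sum.mono_neutral_cong_right) (auto simp: vjoin_def)
  then show ?thesis by (simp add: vnorm_def)
qed

lemma vnorm_vjoin_right:
  "vnorm (Suc m) (\<lambda>i. vjoin m x y i - vjoin m x z i) = \<bar>y 0 - z 0\<bar>"
  by (simp add: vnorm_def vjoin_def)

text \<open>As for \<open>C_l_Lip\<close>, the increment bound already forces dependence on the
  first \<open>n\<close> entries only. No sign is required of the constants; \<open>BLipE\<close>
  supplies nonnegative ones.\<close>

definition BLip :: "nat \<Rightarrow> ((nat \<Rightarrow> real) \<Rightarrow> real) set" where
  "BLip n = {f. (\<exists>B. \<forall>x. \<bar>f x\<bar> \<le> B) \<and> (\<exists>L. \<forall>x y. \<bar>f x - f y\<bar> \<le> L * vnorm n (\<lambda>i. x i - y i))}"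

lemma BLipI:
  assumes "\<And>x. \<bar>f x\<bar> \<le> B" "\<And>x y. \<bar>f x - f y\<bar> \<le> L * vnorm n (\<lambda>i. x i - y i)"
  shows "f \<in> BLip n"
  using assms unfolding BLip_def by blast

lemma BLipE:
  assumes "f \<in> BLip n"
  obtains B L where "B \<ge> 0" "L \<ge> 0" "\<And>x. \<bar>f x\<bar> \<le> B"
    "\<And>x y. \<bar>f x - f y\<bar> \<le> L * vnorm n (\<lambda>i. x i - y i)"
proof -
  obtain B L where B: "\<And>x. \<bar>f x\<bar> \<le> B" and L: "\<And>x y. \<bar>f x - f y\<bar> \<le> L * vnorm n (\<lambda>i. x i - y i)"
    using assms unfolding BLip_def by blast
  have "0 \<le> B" using B[of undefined] by linarith
  moreover have "\<bar>f x - f y\<bar> \<le> max L 0 * vnorm n (\<lambda>i. x i - y i)" for x y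
    using L[of x y] by (rule order_trans) (simp add: mult_right_mono)
  ultimately show ?thesis using that[of B "max L 0"] B by simp
qed

lemma BLip_mono:
  assumes "f \<in> BLip n" "n \<le> k"
  shows "f \<in> BLip k"
proof -
  obtain B L where f: "L \<ge> 0" "\<And>x. \<bar>f x\<bar> \<le> B" "\<And>x y. \<bar>f x - f y\<bar> \<le> L * vnorm n (\<lambda>i. x i - y i)"
    using assms(1) by (elim BLipE) blast
  have "\<bar>f x - f y\<bar> \<le> L * vnorm k (\<lambda>i. x i - y i)" for x y
    using f(3)[of x y] mult_left_mono[OF vnorm_mono[OF assms(2)] f(1)] by (rule order_trans)
  with f(2) show ?thesis by (rule BLipI)
qed

lemma BLip_subset_C_l_Lip: "BLip n \<subseteq> C_l_Lip n"
proof
  fix f assume "f \<in> BLip n"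
  then obtain L where L: "L \<ge> 0" "\<And>x y. \<bar>f x - f y\<bar> \<le> L * vnorm n (\<lambda>i. x i - y i)"
    by (elim BLipE) blast
  have "\<bar>f x - f y\<bar> \<le> (L + 1) * (1 + vnorm n x ^ 0 + vnorm n y ^ 0) * vnorm n (\<lambda>i. x i - y i)" for x y
    using L(2)[of x y] by (rule order_trans) (intro mult_right_mono, use L(1) in auto)
  then show "f \<in> C_l_Lip n" unfolding C_l_Lip_def using L(1)
    by (intro CollectI exI[of _ "L + 1"] conjI exI[of _ 0]) auto
qed

lemma BLip_cong: "f \<in> BLip n \<Longrightarrow> (\<And>i. i < n \<Longrightarrow> x i = y i) \<Longrightarrow> f x = f y"
  using BLip_subset_C_l_Lip C_l_Lip_cong by blast

lemma BLip_const: "(\<lambda>x. c) \<in> BLip n"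
  by (rule BLipI[of _ "\<bar>c\<bar>" 0]) auto

lemma BLip_add:
  assumes "f \<in> BLip n" "g \<in> BLip n"
  shows "(\<lambda>x. f x + g x) \<in> BLip n"
proof -
  obtain B L where f: "\<And>x. \<bar>f x\<bar> \<le> B" "\<And>x y. \<bar>f x - f y\<bar> \<le> L * vnorm n (\<lambda>i. x i - y i)"
    using assms(1) by (elim BLipE) blast
  obtain B' L' where g: "\<And>x. \<bar>g x\<bar> \<le> B'" "\<And>x y. \<bar>g x - g y\<bar> \<le> L' * vnorm n (\<lambda>i. x i - y i)"
    using assms(2) by (elim BLipE) blast
  show ?thesis
  proof (rule BLipI)
    show "\<bar>f x + g x\<bar> \<le> B + B'" for x using f(1)[of x] g(1)[of x] by linarith
    show "\<bar>f x + g x - (f y + g y)\<bar> \<le> (L + L') * vnorm n (\<lambda>i. x i - y i)" for x y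
      using f(2)[of x y] g(2)[of x y] unfolding distrib_right by linarith
  qed
qed

text \<open>Boundedness of both factors is what keeps the product globally Lipschitz.\<close>

lemma BLip_mult:
  assumes "f \<in> BLip n" "g \<in> BLip n"
  shows "(\<lambda>x. f x * g x) \<in> BLip n"
proof -
  obtain B L where f: "B \<ge> 0" "L \<ge> 0" "\<And>x. \<bar>f x\<bar> \<le> B" "\<And>x y. \<bar>f x - f y\<bar> \<le> L * vnorm n (\<lambda>i. x i - y i)"
    using assms(1) by (elim BLipE) blast
  obtain B' L' where g: "B' \<ge> 0" "L' \<ge> 0" "\<And>x. \<bar>g x\<bar> \<le> B'" "\<And>x y. \<bar>g x - g y\<bar> \<le> L' * vnorm n (\<lambda>i. x i - y i)"
    using assms(2) by (elim BLipE) blast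
  show ?thesis
  proof (rule BLipI)
    show "\<bar>f x * g x\<bar> \<le> B * B'" for x
      using f g by (auto simp: abs_mult intro!: mult_mono)
    fix x y
    have "f x * g x - f y * g y = f x * (g x - g y) + (f x - f y) * g y"
      by (simp add: algebra_simps)
    also have "\<bar>\<dots>\<bar> \<le> \<bar>f x\<bar> * \<bar>g x - g y\<bar> + \<bar>f x - f y\<bar> * \<bar>g y\<bar>"
      using abs_triangle_ineq[of "f x * (g x - g y)" "(f x - f y) * g y"] by (simp add: abs_mult)
    also have "\<dots> \<le> B * (L' * vnorm n (\<lambda>i. x i - y i)) + (L * vnorm n (\<lambda>i. x i - y i)) * B'"
      using f g by (intro add_mono mult_mono) auto
    finally show "\<bar>f x * g x - f y * g y\<bar> \<le> (B * L' + L * B') * vnorm n (\<lambda>i. x i - y i)"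
      by (simp add: algebra_simps)
  qed
qed

lemma BLip_cmult: "f \<in> BLip n \<Longrightarrow> (\<lambda>x. c * f x) \<in> BLip n"
  by (rule BLip_mult[OF BLip_const])

lemma BLip_uminus: "f \<in> BLip n \<Longrightarrow> (\<lambda>x. - f x) \<in> BLip n"
  using BLip_cmult[of f n "-1"] by simp

lemma BLip_diff: "f \<in> BLip n \<Longrightarrow> g \<in> BLip n \<Longrightarrow> (\<lambda>x. f x - g x) \<in> BLip n"
  using BLip_add[of f n "\<lambda>x. - g x"] BLip_uminus by simp

lemma BLip_power2: "f \<in> BLip n \<Longrightarrow> (\<lambda>x. (f x)\<^sup>2) \<in> BLip n"
  unfolding power2_eq_square by (rule BLip_mult)

lemma BLip_contraction:
  assumes "f \<in> BLip n" "\<And>a b. \<bar>h a - h b\<bar> \<le> \<bar>a - b\<bar>"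
  shows "(\<lambda>x. h (f x)) \<in> BLip n"
proof -
  obtain B L where f: "\<And>x. \<bar>f x\<bar> \<le> B" "\<And>x y. \<bar>f x - f y\<bar> \<le> L * vnorm n (\<lambda>i. x i - y i)"
    using assms(1) by (elim BLipE) blast
  show ?thesis
  proof (rule BLipI)
    show "\<bar>h (f x)\<bar> \<le> \<bar>h 0\<bar> + B" for x using f(1)[of x] assms(2)[of "f x" 0] by simp
    show "\<bar>h (f x) - h (f y)\<bar> \<le> L * vnorm n (\<lambda>i. x i - y i)" for x y
      using f(2)[of x y] assms(2)[of "f x" "f y"] by simp
  qed
qed

lemma BLip_sum: "(\<And>i. i \<in> I \<Longrightarrow> f i \<in> BLip n) \<Longrightarrow> (\<lambda>x. \<Sum>i\<in>I. f i x) \<in> BLip n"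
  by (induction I rule: infinite_finite_induct) (auto intro: BLip_add BLip_const)

text \<open>Exactly the class of test functions in \<open>identically_distributed\<close>;
  \<open>BLip_real_iff\<close> carries the closure properties over from \<open>BLip\<close>.\<close>

definition BLip_real :: "(real \<Rightarrow> real) \<Rightarrow> bool" where
  "BLip_real h \<longleftrightarrow> bounded (range h) \<and> (\<exists>L. L-lipschitz_on UNIV h)"

lemma BLip_coordinate:
  assumes "BLip_real h" "i < n"
  shows "(\<lambda>x. h (x i)) \<in> BLip n"
proof -
  obtain B where B: "\<And>x. \<bar>h x\<bar> \<le> B"
    using assms(1) unfolding BLip_real_def bounded_iff by auto
  obtain L where L: "L-lipschitz_on UNIV h" using assms(1) unfolding BLip_real_def by blast
  show ?thesis
  proof (rule BLipI)
    show "\<bar>h (x i)\<bar> \<le> B" for x by (rule B)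
    show "\<bar>h (x i) - h (y i)\<bar> \<le> L * vnorm n (\<lambda>i. x i - y i)" for x y
    proof -
      have "\<bar>h (x i) - h (y i)\<bar> \<le> L * \<bar>x i - y i\<bar>"
        using lipschitz_onD[OF L, of "x i" "y i"] by (simp add: dist_real_def)
      also have "\<dots> \<le> L * vnorm n (\<lambda>i. x i - y i)"
        using abs_le_vnorm[OF assms(2), of "\<lambda>i. x i - y i"] lipschitz_on_nonneg[OF L]
        by (intro mult_left_mono) auto
      finally show ?thesis .
    qed
  qed
qed

lemma BLip_real_iff: "BLip_real h \<longleftrightarrow> (\<lambda>x. h (x 0)) \<in> BLip (Suc 0)"
proof
  assume "(\<lambda>x. h (x 0)) \<in> BLip (Suc 0)"
  then obtain B L where h: "L \<ge> 0" "\<And>x. \<bar>h (x (0::nat))\<bar> \<le> B"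
      "\<And>x y. \<bar>h (x 0) - h (y 0)\<bar> \<le> L * vnorm (Suc 0) (\<lambda>i. x i - y i)"
    by (elim BLipE) blast
  have "\<bar>h a\<bar> \<le> B" for a using h(2)[of "\<lambda>_. a"] .
  moreover have "\<bar>h a - h b\<bar> \<le> L * \<bar>a - b\<bar>" for a b
    using h(3)[of "\<lambda>_. a" "\<lambda>_. b"] by (simp add: vnorm_def)
  ultimately show "BLip_real h"
    unfolding BLip_real_def bounded_iff lipschitz_on_def using h(1) by (auto simp: dist_real_def)
qed (simp add: BLip_coordinate)

lemma BLip_real_const: "BLip_real (\<lambda>_. c)"
  unfolding BLip_real_iff by (rule BLip_const)

lemma BLip_real_uminus: "BLip_real h \<Longrightarrow> BLip_real (\<lambda>y. - h y)"
  unfolding BLip_real_iff by (rule BLip_uminus)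

lemma BLip_real_diff: "BLip_real h \<Longrightarrow> BLip_real g \<Longrightarrow> BLip_real (\<lambda>y. h y - g y)"
  unfolding BLip_real_iff by (rule BLip_diff)

lemma BLip_real_bounded:
  assumes "BLip_real h" obtains B where "B \<ge> 0" "\<And>y. \<bar>h y\<bar> \<le> B"
proof -
  obtain B where B: "\<And>y. \<bar>h y\<bar> \<le> B"
    using assms unfolding BLip_real_def bounded_iff by auto
  moreover have "0 \<le> B" using B[of 0] by linarith
  ultimately show ?thesis using that by blast
qed

lemma BLip_real_measurable:
  assumes "BLip_real h" shows "h \<in> borel_measurable borel"
  using assms unfolding BLip_real_def
  by (auto intro: borel_measurable_continuous_onI lipschitz_on_continuous_on)

text \<open>Only entry 0 of the second argument of \<open>vjoin\<close> is read here, so a constant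
  sequence stands for the single new coordinate, just as in \<open>independent_seq\<close>.\<close>

lemma BLip_section:
  assumes "f \<in> BLip (Suc m)"
  shows "BLip_real (\<lambda>y. f (vjoin m x (\<lambda>_. y)))"
proof -
  obtain B L where f: "\<And>x. \<bar>f x\<bar> \<le> B" "\<And>x y. \<bar>f x - f y\<bar> \<le> L * vnorm (Suc m) (\<lambda>i. x i - y i)"
    using assms by (elim BLipE) blast
  show ?thesis unfolding BLip_real_iff
  proof (rule BLipI)
    show "\<bar>f (vjoin m x (\<lambda>_. z 0))\<bar> \<le> B" for z :: "nat \<Rightarrow> real" by (rule f)
    show "\<bar>f (vjoin m x (\<lambda>_. y 0)) - f (vjoin m x (\<lambda>_. z 0))\<bar> \<le> L * vnorm (Suc 0) (\<lambda>i. y i - z i)" for y z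
      using f(2)[of "vjoin m x (\<lambda>_. y 0)" "vjoin m x (\<lambda>_. z 0)"] vnorm_vjoin_right[of m x "\<lambda>_. y 0" "\<lambda>_. z 0"]
      by (simp add: vnorm_def)
  qed
qed


section \<open>Polynomially growing functions: closure properties and truncation\<close>

lemma C_l_Lip_mono:
  assumes "f \<in> C_l_Lip n" "n \<le> k"
  shows "f \<in> C_l_Lip k"
proof -
  obtain C and m :: nat where C: "C > 0"
    "\<And>x y. \<bar>f x - f y\<bar> \<le> C * (1 + vnorm n x ^ m + vnorm n y ^ m) * vnorm n (\<lambda>i. x i - y i)"
    using assms(1) unfolding C_l_Lip_def by blast
  have "\<bar>f x - f y\<bar> \<le> C * (1 + vnorm k x ^ m + vnorm k y ^ m) * vnorm k (\<lambda>i. x i - y i)" for x y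
  proof (rule order_trans[OF C(2)[of x y]])
    show "C * (1 + vnorm n x ^ m + vnorm n y ^ m) * vnorm n (\<lambda>i. x i - y i)
      \<le> C * (1 + vnorm k x ^ m + vnorm k y ^ m) * vnorm k (\<lambda>i. x i - y i)"
      using C(1) by (intro mult_mono add_mono power_mono vnorm_mono assms(2)) (auto intro!: add_nonneg_nonneg)
  qed
  then show ?thesis unfolding C_l_Lip_def using C(1) by blast
qed

lemma power_le_one_plus_power:
  fixes a :: real
  assumes "0 \<le> a" "m \<le> k" shows "a ^ m \<le> 1 + a ^ k"
proof (cases "a \<le> 1")
  case True
  then show ?thesis using power_le_one[OF assms(1), of m] zero_le_power[OF assms(1), of k] by linarith
next
  case False
  then have "a ^ m \<le> a ^ k" using assms(2) by (intro power_increasing) auto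
  then show ?thesis by linarith
qed

text \<open>Both growth exponents are raised to their maximum \<open>p\<close>. By
  \<open>power_le_one_plus_power\<close> this enlarges each weight at most threefold, whence the
  constant \<open>3 * (C + D)\<close>.\<close>

lemma C_l_Lip_add:
  assumes "f \<in> C_l_Lip n" "g \<in> C_l_Lip n"
  shows "(\<lambda>x. f x + g x) \<in> C_l_Lip n"
proof -
  obtain C and m :: nat where f: "C > 0"
    "\<And>x y. \<bar>f x - f y\<bar> \<le> C * (1 + vnorm n x ^ m + vnorm n y ^ m) * vnorm n (\<lambda>i. x i - y i)"
    using assms(1) unfolding C_l_Lip_def by blast
  obtain D and k :: nat where g: "D > 0"
    "\<And>x y. \<bar>g x - g y\<bar> \<le> D * (1 + vnorm n x ^ k + vnorm n y ^ k) * vnorm n (\<lambda>i. x i - y i)"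
    using assms(2) unfolding C_l_Lip_def by blast
  define p where "p = max m k"
  have "\<bar>f x + g x - (f y + g y)\<bar>
      \<le> (3 * (C + D)) * (1 + vnorm n x ^ p + vnorm n y ^ p) * vnorm n (\<lambda>i. x i - y i)" for x y
  proof -
    define P where "P = 1 + vnorm n x ^ p + vnorm n y ^ p"
    have bound: "1 + vnorm n x ^ q + vnorm n y ^ q \<le> 3 * P" if "q \<le> p" for q
      using power_le_one_plus_power[OF vnorm_nonneg[of n x] that]
        power_le_one_plus_power[OF vnorm_nonneg[of n y] that] zero_le_power[OF vnorm_nonneg[of n x], of p]
        zero_le_power[OF vnorm_nonneg[of n y], of p]
      unfolding P_def distrib_left by linarith
    have "\<bar>f x - f y\<bar> \<le> C * (3 * P) * vnorm n (\<lambda>i. x i - y i)"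
      using f(1) by (intro order_trans[OF f(2)] mult_right_mono mult_left_mono bound) (auto simp: p_def)
    moreover have "\<bar>g x - g y\<bar> \<le> D * (3 * P) * vnorm n (\<lambda>i. x i - y i)"
      using g(1) by (intro order_trans[OF g(2)] mult_right_mono mult_left_mono bound) (auto simp: p_def)
    ultimately have "\<bar>f x + g x - (f y + g y)\<bar> \<le> C * (3 * P) * vnorm n (\<lambda>i. x i - y i) + D * (3 * P) * vnorm n (\<lambda>i. x i - y i)"
      by linarith
    then show ?thesis unfolding P_def[symmetric] by (simp add: algebra_simps)
  qed
  then show ?thesis unfolding C_l_Lip_def using f(1) g(1)
    by (intro CollectI exI[of _ "3 * (C + D)"] conjI exI[of _ p]) auto
qed

lemma C_l_Lip_cmult:
  assumes "f \<in> C_l_Lip n" shows "(\<lambda>x. a * f x) \<in> C_l_Lip n"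
proof -
  obtain C and m :: nat where C: "C > 0"
    "\<And>x y. \<bar>f x - f y\<bar> \<le> C * (1 + vnorm n x ^ m + vnorm n y ^ m) * vnorm n (\<lambda>i. x i - y i)"
    using assms unfolding C_l_Lip_def by blast
  have "\<bar>a * f x - a * f y\<bar>
      \<le> ((\<bar>a\<bar> + 1) * C) * (1 + vnorm n x ^ m + vnorm n y ^ m) * vnorm n (\<lambda>i. x i - y i)" for x y
  proof -
    have "\<bar>a * f x - a * f y\<bar> \<le> (\<bar>a\<bar> + 1) * \<bar>f x - f y\<bar>"
      by (simp add: right_diff_distrib[symmetric] abs_mult distrib_right)
    also have "\<dots> \<le> (\<bar>a\<bar> + 1) * (C * (1 + vnorm n x ^ m + vnorm n y ^ m) * vnorm n (\<lambda>i. x i - y i))"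
      by (intro mult_left_mono C(2)) simp
    finally show ?thesis by (simp add: mult.assoc)
  qed
  then show ?thesis unfolding C_l_Lip_def using C(1)
    by (intro CollectI exI[of _ "(\<bar>a\<bar> + 1) * C"] conjI exI[of _ m]) auto
qed

text \<open>A bump of slope 1: equal to 1 on the ball of radius \<open>k\<close>, zero outside the
  ball of radius \<open>k + 1\<close>.\<close>

definition cutoff :: "nat \<Rightarrow> nat \<Rightarrow> (nat \<Rightarrow> real) \<Rightarrow> real" where
  "cutoff n k x = max 0 (min 1 (real k + 1 - vnorm n x))"

lemma cutoff_bounds: "0 \<le> cutoff n k x" "cutoff n k x \<le> 1"
  by (auto simp: cutoff_def)

lemma cutoff_diff: "\<bar>cutoff n k x - cutoff n k y\<bar> \<le> vnorm n (\<lambda>i. x i - y i)"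
  using vnorm_diff[of n x y] by (auto simp: cutoff_def max_def min_def)

lemma cutoff_BLip: "cutoff n k \<in> BLip n"
proof (rule BLipI)
  show "\<bar>cutoff n k x\<bar> \<le> 1" for x using cutoff_bounds[of n k x] by simp
  show "\<bar>cutoff n k x - cutoff n k y\<bar> \<le> 1 * vnorm n (\<lambda>i. x i - y i)" for x y
    using cutoff_diff[of n k x y] by simp
qed

text \<open>A function of polynomial growth is Lipschitz on balls only. The cutoff confines it to a
  ball, and the clipping level bounds the term in which the cutoff itself varies.\<close>

lemma clip_cutoff_BLip:
  assumes "f \<in> C_l_Lip n" "0 \<le> c"
  shows "(\<lambda>x. max (- c) (min c (f x)) * cutoff n k x) \<in> BLip n"
proof -
  obtain C and m :: nat where C: "C > 0"
    "\<And>x y. \<bar>f x - f y\<bar> \<le> C * (1 + vnorm n x ^ m + vnorm n y ^ m) * vnorm n (\<lambda>i. x i - y i)"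
    using assms(1) unfolding C_l_Lip_def by blast
  \<comment> \<open>A Lipschitz constant of \<open>f\<close> on the ball of radius
    \<open>real k + 1\<close>, outside which the cutoff vanishes.\<close>
  define D where "D = C * (1 + (real k + 1) ^ m + (real k + 1) ^ m)"
  have D: "D \<ge> 0" using C(1) by (simp add: D_def)
  define g where "g x = max (- c) (min c (f x))" for x
  have g: "\<bar>g x\<bar> \<le> c" for x using assms(2) by (auto simp: g_def)
  have far: "cutoff n k x = 0" if "vnorm n x > real k + 1" for x
    using that by (simp add: cutoff_def)
  have near: "\<bar>g x - g y\<bar> \<le> D * vnorm n (\<lambda>i. x i - y i)"
    if "vnorm n x \<le> real k + 1" "vnorm n y \<le> real k + 1" for x y
  proof -
    have "\<bar>g x - g y\<bar> \<le> \<bar>f x - f y\<bar>" by (auto simp: g_def max_def min_def)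
    also have "\<dots> \<le> C * (1 + vnorm n x ^ m + vnorm n y ^ m) * vnorm n (\<lambda>i. x i - y i)" by (rule C(2))
    also have "\<dots> \<le> D * vnorm n (\<lambda>i. x i - y i)"
      unfolding D_def using that C(1) by (intro mult_right_mono mult_left_mono add_mono power_mono) auto
    finally show ?thesis .
  qed
  have "\<bar>g x * cutoff n k x - g y * cutoff n k y\<bar> \<le> (c + D) * vnorm n (\<lambda>i. x i - y i)" for x y
  proof -
    \<comment> \<open>The point \<open>z\<close> stays free: when one of \<open>x\<close> and
      \<open>y\<close> lies outside the ball, the other is taken for \<open>z\<close> and the
      remaining term of the product rule is zero.\<close>
    have A: "\<bar>g z * (cutoff n k x - cutoff n k y)\<bar> \<le> c * vnorm n (\<lambda>i. x i - y i)" for z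
      unfolding abs_mult using g cutoff_diff assms(2) by (intro mult_mono) auto
    consider "vnorm n y > real k + 1" | "vnorm n x > real k + 1"
      | "vnorm n x \<le> real k + 1" "vnorm n y \<le> real k + 1" by linarith
    then show ?thesis
    proof cases
      case 1
      have "0 \<le> D * vnorm n (\<lambda>i. x i - y i)" using D by simp
      then show ?thesis using A[of x] far[OF 1] by (simp add: distrib_right)
    next
      case 2
      have "0 \<le> D * vnorm n (\<lambda>i. x i - y i)" using D by simp
      then show ?thesis using A[of y] far[OF 2] by (simp add: distrib_right)
    next
      case 3
      have "\<bar>(g x - g y) * cutoff n k y\<bar> \<le> (D * vnorm n (\<lambda>i. x i - y i)) * 1"
        unfolding abs_mult using near[OF 3] cutoff_bounds[of n k y] D by (intro mult_mono) auto
      then have "\<bar>g x * (cutoff n k x - cutoff n k y) + (g x - g y) * cutoff n k y\<bar>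
        \<le> c * vnorm n (\<lambda>i. x i - y i) + D * vnorm n (\<lambda>i. x i - y i)"
        using A[of x] by linarith
      then show ?thesis by (simp add: algebra_simps)
    qed
  qed
  moreover have "\<bar>g x * cutoff n k x\<bar> \<le> c * 1" for x
    unfolding abs_mult using g cutoff_bounds[of n k x] assms(2) by (intro mult_mono) auto
  ultimately show ?thesis unfolding g_def by (intro BLipI)
qed

subsection \<open>Variables of finite absolute mean\<close>

context sublinear_expectation_space
begin

lemma H_add: "Z \<in> H \<Longrightarrow> W \<in> H \<Longrightarrow> (\<lambda>\<omega>. Z \<omega> + W \<omega>) \<in> H"
  using H_linear unfolding linear_space_def by blast

lemma H_cmult: "Z \<in> H \<Longrightarrow> (\<lambda>\<omega>. c * Z \<omega>) \<in> H"
  using H_linear unfolding linear_space_def by blast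

lemma H_uminus: "Z \<in> H \<Longrightarrow> (\<lambda>\<omega>. - Z \<omega>) \<in> H"
  using H_cmult[of Z "-1"] by simp

lemma H_contraction:
  assumes "Z \<in> H" "\<And>a b. \<bar>h a - h b\<bar> \<le> \<bar>a - b\<bar>"
  shows "(\<lambda>\<omega>. h (Z \<omega>)) \<in> H"
proof -
  have "\<bar>h (x 0) - h (y 0)\<bar> \<le> 1 * (1 + vnorm 1 x ^ 0 + vnorm 1 y ^ 0) * vnorm 1 (\<lambda>i. x i - y i)"
    for x y :: "nat \<Rightarrow> real"
    by (rule order_trans[OF assms(2)]) (simp add: vnorm_def)
  then have "(\<lambda>x. h (x 0)) \<in> C_l_Lip 1"
    unfolding C_l_Lip_def by (intro CollectI exI[of _ 1] conjI exI[of _ 0]) auto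
  from H_closed[OF _ this, of "\<lambda>_. Z"] assms(1) show ?thesis by simp
qed

lemma H_abs: "Z \<in> H \<Longrightarrow> (\<lambda>\<omega>. \<bar>Z \<omega>\<bar>) \<in> H"
  by (rule H_contraction) auto

lemma H_const: "(\<lambda>_. c) \<in> H"
proof -
  have "(\<lambda>_. 0) \<in> H" using H_linear unfolding linear_space_def by blast
  then show ?thesis using H_contraction[of "\<lambda>_. 0" "\<lambda>_. c"] by simp
qed

abbreviation mean :: "('a \<Rightarrow> real) \<Rightarrow> real" where
  "mean Z \<equiv> real_of_ereal (E Z)"

text \<open>A finite absolute mean makes \<open>E\<close> finite at \<open>Z\<close> and at its
  negative, so that on this set the real-valued \<open>mean\<close> loses no information.\<close>

definition Fin :: "('a \<Rightarrow> real) set" where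
  "Fin = {Z \<in> H. E (\<lambda>\<omega>. \<bar>Z \<omega>\<bar>) < \<infinity>}"

lemma Fin_imp_H: "Z \<in> Fin \<Longrightarrow> Z \<in> H"
  by (simp add: Fin_def)

lemma Fin_dominated:
  assumes "Z \<in> H" "W \<in> Fin" "\<And>\<omega>. \<omega> \<in> space M \<Longrightarrow> \<bar>Z \<omega>\<bar> \<le> \<bar>W \<omega>\<bar>"
  shows "Z \<in> Fin"
proof -
  have "E (\<lambda>\<omega>. \<bar>Z \<omega>\<bar>) \<le> E (\<lambda>\<omega>. \<bar>W \<omega>\<bar>)"
    using assms by (intro E_mono H_abs) (auto simp: Fin_def)
  then show ?thesis using assms by (auto simp: Fin_def)
qed

lemma Fin_bounded:
  assumes "Z \<in> H" "\<And>\<omega>. \<omega> \<in> space M \<Longrightarrow> \<bar>Z \<omega>\<bar> \<le> B"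
  shows "Z \<in> Fin"
proof (rule Fin_dominated[of _ "\<lambda>_. B"])
  show "(\<lambda>_. B) \<in> Fin" by (simp add: Fin_def H_const E_const)
qed (use assms in force)+

lemma Fin_const: "(\<lambda>_. c) \<in> Fin"
  by (rule Fin_bounded[OF H_const]) auto

lemma Fin_abs: "Z \<in> Fin \<Longrightarrow> (\<lambda>\<omega>. \<bar>Z \<omega>\<bar>) \<in> Fin"
  using H_abs unfolding Fin_def by simp

lemma Fin_uminus: "Z \<in> Fin \<Longrightarrow> (\<lambda>\<omega>. - Z \<omega>) \<in> Fin"
  using H_uminus unfolding Fin_def by simp

lemma E_eq_mean:
  assumes "Z \<in> Fin"
  shows "E Z = ereal (mean Z)"
proof -
  have H: "Z \<in> H" "(\<lambda>\<omega>. - Z \<omega>) \<in> H" using assms by (auto simp: Fin_def H_uminus)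
  have abs: "E (\<lambda>\<omega>. \<bar>Z \<omega>\<bar>) \<noteq> \<infinity>" using assms by (auto simp: Fin_def)
  have "E Z \<le> E (\<lambda>\<omega>. \<bar>Z \<omega>\<bar>)" by (rule E_mono[OF H_abs[OF H(1)] H(1)]) simp
  then have fin1: "E Z \<noteq> \<infinity>" using abs by auto
  have "E (\<lambda>\<omega>. - Z \<omega>) \<le> E (\<lambda>\<omega>. \<bar>Z \<omega>\<bar>)" by (rule E_mono[OF H_abs[OF H(1)] H(2)]) simp
  then have fin: "E Z \<noteq> \<infinity>" "E (\<lambda>\<omega>. - Z \<omega>) \<noteq> \<infinity>" using abs fin1 by auto
  \<comment> \<open>Both values are known not to be \<open>\<infinity>\<close> by now, so
    subadditivity applies; since \<open>Z\<close> and its negative add up to 0, it excludes the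
    value minus infinity.\<close>
  have "E (\<lambda>\<omega>. Z \<omega> + - Z \<omega>) \<le> E Z + E (\<lambda>\<omega>. - Z \<omega>)"
    by (rule E_subadd) (use H fin in auto)
  then have "0 \<le> E Z + E (\<lambda>\<omega>. - Z \<omega>)" by (simp add: E_const zero_ereal_def)
  then have "E Z \<noteq> - \<infinity>" using fin by (cases "E (\<lambda>\<omega>. - Z \<omega>)") auto
  with fin show ?thesis by (cases "E Z") auto
qed

lemma Fin_obtain_real:
  assumes "Z \<in> Fin" obtains a where "E Z = ereal a"
  by (rule that[OF E_eq_mean[OF assms]])

lemma Fin_add:
  assumes "Z \<in> Fin" "W \<in> Fin"
  shows "(\<lambda>\<omega>. Z \<omega> + W \<omega>) \<in> Fin"
proof -
  have H: "Z \<in> H" "W \<in> H" using assms by (auto simp: Fin_def)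
  obtain a where a: "E (\<lambda>\<omega>. \<bar>Z \<omega>\<bar>) = ereal a" using Fin_obtain_real[OF Fin_abs[OF assms(1)]] .
  obtain b where b: "E (\<lambda>\<omega>. \<bar>W \<omega>\<bar>) = ereal b" using Fin_obtain_real[OF Fin_abs[OF assms(2)]] .
  have "E (\<lambda>\<omega>. \<bar>Z \<omega> + W \<omega>\<bar>) \<le> E (\<lambda>\<omega>. \<bar>Z \<omega>\<bar> + \<bar>W \<omega>\<bar>)"
    using H by (intro E_mono H_add H_abs) auto
  also have "\<dots> \<le> E (\<lambda>\<omega>. \<bar>Z \<omega>\<bar>) + E (\<lambda>\<omega>. \<bar>W \<omega>\<bar>)"
    using H by (intro E_subadd H_abs) (simp_all add: a b)
  also have "\<dots> < \<infinity>" by (simp add: a b)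
  finally show ?thesis using H by (simp add: Fin_def H_add)
qed

lemma Fin_cmult:
  assumes "Z \<in> Fin"
  shows "(\<lambda>\<omega>. c * Z \<omega>) \<in> Fin"
proof -
  have "E (\<lambda>\<omega>. \<bar>c * Z \<omega>\<bar>) = ereal \<bar>c\<bar> * E (\<lambda>\<omega>. \<bar>Z \<omega>\<bar>)"
    using E_scale[OF H_abs, of Z "\<bar>c\<bar>"] assms by (simp add: Fin_def abs_mult)
  also have "\<dots> < \<infinity>"
  proof -
    obtain a where "E (\<lambda>\<omega>. \<bar>Z \<omega>\<bar>) = ereal a" using Fin_obtain_real[OF Fin_abs[OF assms]] .
    then show ?thesis by simp
  qed
  finally show ?thesis using assms by (simp add: Fin_def H_cmult)
qed

lemma mean_const [simp]: "mean (\<lambda>_. c) = c"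
  by (simp add: E_const)

lemma mean_mono:
  assumes "Z \<in> Fin" "W \<in> Fin" "\<And>\<omega>. \<omega> \<in> space M \<Longrightarrow> Z \<omega> \<le> W \<omega>"
  shows "mean Z \<le> mean W"
proof -
  have "E Z \<le> E W" using assms by (intro E_mono) (auto simp: Fin_def)
  then show ?thesis
    using Fin_obtain_real[OF assms(1)] Fin_obtain_real[OF assms(2)]
    by (metis ereal_less_eq(3) real_of_ereal.simps(1))
qed

lemma mean_add_le:
  assumes "Z \<in> Fin" "W \<in> Fin"
  shows "mean (\<lambda>\<omega>. Z \<omega> + W \<omega>) \<le> mean Z + mean W"
proof -
  obtain a where a: "E Z = ereal a" using Fin_obtain_real[OF assms(1)] .
  obtain b where b: "E W = ereal b" using Fin_obtain_real[OF assms(2)] .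
  have "ereal (mean (\<lambda>\<omega>. Z \<omega> + W \<omega>)) = E (\<lambda>\<omega>. Z \<omega> + W \<omega>)"
    using assms by (intro E_eq_mean[symmetric] Fin_add)
  also have "\<dots> \<le> E Z + E W"
    using assms by (intro E_subadd) (auto simp: Fin_def a b)
  also have "\<dots> = ereal (mean Z + mean W)" by (simp add: a b)
  finally show ?thesis by simp
qed

lemma mean_cmult:
  assumes "Z \<in> Fin" "0 \<le> c"
  shows "mean (\<lambda>\<omega>. c * Z \<omega>) = c * mean Z"
  using E_scale[of Z c] assms by (simp add: Fin_def)

text \<open>Subadditivity gives one inequality; the other comes from adding \<open>- c\<close>
  back.\<close>

lemma mean_add_const:
  assumes "Z \<in> Fin"
  shows "mean (\<lambda>\<omega>. Z \<omega> + c) = mean Z + c"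
  using mean_add_le[OF assms Fin_const, of c]
    mean_add_le[OF Fin_add[OF assms Fin_const] Fin_const, of c "- c"] by simp

text \<open>Subadditivity for \<open>Z\<close> and its negative. The right-hand side is the gap
  between upper and lower mean, which is later shown to vanish on \<open>H_tilde\<close>.\<close>

lemma mean_uminus_ge: "Z \<in> Fin \<Longrightarrow> 0 \<le> mean Z + mean (\<lambda>\<omega>. - Z \<omega>)"
  using mean_add_le[OF _ Fin_uminus, of Z Z] by simp

text \<open>The one-sided substitute for linearity: subadditivity applied to the bound
  \<open>Z \<le> W + R\<close>.\<close>

lemma mean_diff_le:
  assumes "Z \<in> Fin" "W \<in> Fin" "R \<in> Fin" "\<And>\<omega>. \<omega> \<in> space M \<Longrightarrow> Z \<omega> - W \<omega> \<le> R \<omega>"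
  shows "mean Z - mean W \<le> mean R"
proof -
  have "mean Z \<le> mean (\<lambda>\<omega>. W \<omega> + R \<omega>)"
    using assms by (intro mean_mono Fin_add) (auto simp: algebra_simps)
  also have "\<dots> \<le> mean W + mean R" using assms by (intro mean_add_le)
  finally show ?thesis by simp
qed

lemma Fin_tail:
  assumes "Y \<in> Fin" shows "(\<lambda>\<omega>. max (\<bar>Y \<omega>\<bar> - c) 0) \<in> Fin"
proof (rule Fin_dominated)
  show "(\<lambda>\<omega>. max (\<bar>Y \<omega>\<bar> - c) 0) \<in> H"
    by (rule H_contraction[OF Fin_imp_H[OF assms]]) auto
  show "(\<lambda>\<omega>. \<bar>Y \<omega>\<bar> + \<bar>c\<bar>) \<in> Fin" by (intro Fin_add Fin_abs assms Fin_const)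
qed auto

text \<open>Replacing \<open>Z\<close> by \<open>W\<close> changes the upper mean of
  \<open>Z\<close> and that of its negative by at most \<open>mean R\<close> each. A vanishing gap
  is thus inherited by limits in the seminorm given by the mean of the absolute value.\<close>

lemma mean_symmetric_approx:
  assumes Z: "Z \<in> Fin"
    and approx: "\<And>e. 0 < e \<Longrightarrow> \<exists>W R. W \<in> Fin \<and> R \<in> Fin \<and> mean (\<lambda>\<omega>. - W \<omega>) = - mean W \<and>
      (\<forall>\<omega>\<in>space M. \<bar>Z \<omega> - W \<omega>\<bar> \<le> R \<omega>) \<and> mean R \<le> e"
  shows "mean (\<lambda>\<omega>. - Z \<omega>) = - mean Z"
proof -
  have "mean Z + mean (\<lambda>\<omega>. - Z \<omega>) \<le> 0 + e" if e: "0 < e" for e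
  proof -
    obtain W R where W: "W \<in> Fin" "R \<in> Fin" "mean (\<lambda>\<omega>. - W \<omega>) = - mean W"
      "\<And>\<omega>. \<omega> \<in> space M \<Longrightarrow> \<bar>Z \<omega> - W \<omega>\<bar> \<le> R \<omega>" "mean R \<le> e / 2"
      using approx[of "e / 2"] e by auto
    have "mean Z - mean W \<le> mean R"
      by (intro mean_diff_le Z W(1,2)) (use W(4) in fastforce)
    moreover have "mean (\<lambda>\<omega>. - Z \<omega>) - mean (\<lambda>\<omega>. - W \<omega>) \<le> mean R"
      by (intro mean_diff_le Fin_uminus Z W(1,2)) (use W(4) in fastforce)
    ultimately show ?thesis using W(3,5) by simp
  qed
  then have "mean Z + mean (\<lambda>\<omega>. - Z \<omega>) \<le> 0" by (rule field_le_epsilon)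
  then show ?thesis using mean_uminus_ge[OF Z] by linarith
qed

end

subsection \<open>Block averages of an i.i.d. sequence\<close>

locale iid_sequence = sublinear_expectation_space +
  fixes X :: "nat \<Rightarrow> 'a \<Rightarrow> real"
  assumes X_in_H: "\<And>i. X i \<in> H"
    and indep: "independent_seq H E X"
    and ident: "identically_distributed E X"
begin

lemma C_l_Lip_in_H:
  assumes "f \<in> C_l_Lip n" "n \<ge> 1"
  shows "(\<lambda>\<omega>. f (\<lambda>i. X i \<omega>)) \<in> H"
  using H_closed[OF assms(2,1)] X_in_H by blast

lemma BLip_in_Fin:
  assumes "f \<in> BLip n"
  shows "(\<lambda>\<omega>. f (\<lambda>i. X i \<omega>)) \<in> Fin"
proof -
  obtain B where "\<And>x. \<bar>f x\<bar> \<le> B" using assms by (elim BLipE) blast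
  moreover have "f \<in> C_l_Lip (max n 1)"
    using BLip_mono[OF assms, of "max n 1"] BLip_subset_C_l_Lip by auto
  ultimately show ?thesis using C_l_Lip_in_H by (intro Fin_bounded) auto
qed

lemma BLip_real_in_Fin: "BLip_real h \<Longrightarrow> (\<lambda>\<omega>. h (X i \<omega>)) \<in> Fin"
  using BLip_in_Fin[OF BLip_coordinate[of h i "Suc i"]] by simp

lemma mean_ident:
  assumes "BLip_real h"
  shows "mean (\<lambda>\<omega>. h (X i \<omega>)) = mean (\<lambda>\<omega>. h (X 0 \<omega>))"
proof -
  have "E (\<lambda>\<omega>. h (X i \<omega>)) = E (\<lambda>\<omega>. h (X 0 \<omega>))"
    using ident assms unfolding identically_distributed_def BLip_real_def by blast
  then show ?thesis by (rule arg_cong)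
qed

section \<open>Conditioning on the past and Chebyshev estimates for blocks\<close>

definition section_mean :: "nat \<Rightarrow> ((nat \<Rightarrow> real) \<Rightarrow> real) \<Rightarrow> (nat \<Rightarrow> real) \<Rightarrow> real" where
  "section_mean m f x = mean (\<lambda>\<omega>. f (vjoin m x (\<lambda>_. X m \<omega>)))"

lemma section_in_Fin: "f \<in> BLip (Suc m) \<Longrightarrow> (\<lambda>\<omega>. f (vjoin m x (\<lambda>_. X m \<omega>))) \<in> Fin"
  by (rule BLip_real_in_Fin[OF BLip_section])

text \<open>Bound and Lipschitz constant are inherited: sections at \<open>x\<close> and
  \<open>y\<close> differ by at most a constant, and constants pass through
  \<open>mean\<close>.\<close>

lemma section_mean_BLip:
  assumes "f \<in> BLip (Suc m)"
  shows "section_mean m f \<in> BLip m"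
proof -
  obtain B L where f: "\<And>x. \<bar>f x\<bar> \<le> B" "\<And>x y. \<bar>f x - f y\<bar> \<le> L * vnorm (Suc m) (\<lambda>i. x i - y i)"
    using assms by (elim BLipE) blast
  note fin = section_in_Fin[OF assms]
  show ?thesis
  proof (rule BLipI)
    show "\<bar>section_mean m f x\<bar> \<le> B" for x
    proof -
      have "f y \<le> B" "- B \<le> f y" for y using f(1)[of y] by auto
      then have "section_mean m f x \<le> mean (\<lambda>_. B)" "mean (\<lambda>_. - B) \<le> section_mean m f x"
        unfolding section_mean_def by (intro mean_mono fin Fin_const; simp)+
      then show ?thesis by simp
    qed
    have *: "section_mean m f x - section_mean m f y \<le> L * vnorm m (\<lambda>i. x i - y i)" for x y
    proof -
      have "f (vjoin m x z) - f (vjoin m y z) \<le> L * vnorm m (\<lambda>i. x i - y i)" for z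
        using f(2)[of "vjoin m x z" "vjoin m y z"] vnorm_vjoin_left[of m 1 x z y] by simp
      then have "section_mean m f x - section_mean m f y \<le> mean (\<lambda>_. L * vnorm m (\<lambda>i. x i - y i))"
        unfolding section_mean_def by (intro mean_diff_le fin Fin_const) auto
      then show ?thesis by simp
    qed
    show "\<bar>section_mean m f x - section_mean m f y\<bar> \<le> L * vnorm m (\<lambda>i. x i - y i)" for x y
      using *[of x y] *[of y x] vnorm_minus_commute[of m x y] by simp
  qed
qed

text \<open>The only point where independence enters; it serves as Fubini's theorem for the last
  variable.\<close>

lemma mean_eq_section_mean:
  assumes f: "f \<in> BLip (Suc m)"
  shows "mean (\<lambda>\<omega>. f (\<lambda>i. X i \<omega>)) = mean (\<lambda>\<omega>. section_mean m f (\<lambda>i. X i \<omega>))"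
proof -
  have join: "f (vjoin m (\<lambda>i. X i \<omega>) (\<lambda>_. X m \<omega>)) = f (\<lambda>i. X i \<omega>)" for \<omega>
    by (rule BLip_cong[OF f]) (auto simp: vjoin_def less_Suc_eq)
  show ?thesis
  proof (cases "m = 0")
    \<comment> \<open>Independence is assumed from index 1 on only. Without a past the section does
      not depend on \<open>x\<close>, and its mean is a constant.\<close>
    case True
    have "f (vjoin 0 x (\<lambda>_. X 0 \<omega>)) = f (\<lambda>i. X i \<omega>)" for x \<omega>
      using f True by (intro BLip_cong[of f 1]) (auto simp: vjoin_def)
    then show ?thesis using True by (simp add: section_mean_def)
  next
    case False
    \<comment> \<open>The guards concern the absolute value of \<open>f\<close>. It is bounded
      Lipschitz too, so its section mean yields a variable in \<open>Fin\<close>.\<close>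
    have fa: "(\<lambda>x. \<bar>f x\<bar>) \<in> BLip (Suc m)" by (rule BLip_contraction[OF f]) auto
    have abs_mean: "(\<lambda>\<omega>. mean (\<lambda>\<omega>'. \<bar>f (vjoin m (\<lambda>i. X i \<omega>) (\<lambda>_. X m \<omega>'))\<bar>)) \<in> Fin"
      using BLip_in_Fin[OF section_mean_BLip[OF fa]] unfolding section_mean_def .
    have "independent_to H E 1 (\<lambda>_. X m) m X"
      using indep False unfolding independent_seq_def by auto
    moreover have "f \<in> C_l_Lip (m + 1)" using f BLip_subset_C_l_Lip by auto
    moreover have "\<forall>x. E (\<lambda>\<omega>. \<bar>f (vjoin m x (\<lambda>_. X m \<omega>))\<bar>) < \<infinity>"
      using section_in_Fin[OF f] unfolding Fin_def by blast
    moreover have "(\<lambda>\<omega>. mean (\<lambda>\<omega>'. \<bar>f (vjoin m (\<lambda>i. X i \<omega>) (\<lambda>_. X m \<omega>'))\<bar>)) \<in> H"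
      using abs_mean by (rule Fin_imp_H)
    moreover have "E (\<lambda>\<omega>. \<bar>mean (\<lambda>\<omega>'. \<bar>f (vjoin m (\<lambda>i. X i \<omega>) (\<lambda>_. X m \<omega>'))\<bar>)\<bar>) < \<infinity>"
      using abs_mean unfolding Fin_def by blast
    moreover have "(\<lambda>\<omega>. mean (\<lambda>\<omega>'. f (vjoin m (\<lambda>i. X i \<omega>) (\<lambda>_. X m \<omega>')))) \<in> H"
      using Fin_imp_H[OF BLip_in_Fin[OF section_mean_BLip[OF f]]] unfolding section_mean_def .
    ultimately have "E (\<lambda>\<omega>. f (vjoin m (\<lambda>i. X i \<omega>) (\<lambda>_. X m \<omega>))) = E (\<lambda>\<omega>. section_mean m f (\<lambda>i. X i \<omega>))"
      unfolding independent_to_def Let_def section_mean_def by blast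
    then show ?thesis by (simp add: join)
  qed
qed

text \<open>For \<open>0 \<le> c\<close> homogeneity even gives equality; for negative
  \<open>c\<close> only \<open>mean_uminus_ge\<close> is available. This is why the block estimates
  run in one direction.\<close>

lemma mean_mult_centered_nonneg:
  assumes "BLip_real h" "mean (\<lambda>\<omega>. h (X i \<omega>)) = 0"
  shows "0 \<le> mean (\<lambda>\<omega>. c * h (X i \<omega>))"
proof -
  note fin = BLip_real_in_Fin[OF assms(1), of i]
  show ?thesis
  proof (cases "c \<ge> 0")
    case True
    then show ?thesis using mean_cmult[OF fin True] assms(2) by simp
  next
    case False
    have "0 \<le> mean (\<lambda>\<omega>. - h (X i \<omega>))" using mean_uminus_ge[OF fin] assms(2) by simp
    moreover have "mean (\<lambda>\<omega>. (- c) * - h (X i \<omega>)) = (- c) * mean (\<lambda>\<omega>. - h (X i \<omega>))"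
      using False by (intro mean_cmult Fin_uminus fin) auto
    ultimately show ?thesis using False by (simp add: mult_nonpos_nonneg)
  qed
qed

text \<open>In the expansion of the square, the cross term \<open>- 2 b w T\<close> has a nonnegative mean
  whatever the sign of \<open>w\<close>, because a vanishing mean of \<open>T\<close> forces \<open>- T\<close> to have a nonnegative mean.\<close>

lemma mean_square_step:
  assumes f: "f \<in> BLip m" "\<And>x. 0 \<le> f x" and w: "w \<in> BLip m" and b: "0 \<le> b"
    and T: "BLip_real T" "\<And>y. \<bar>T y\<bar> \<le> K" "mean (\<lambda>\<omega>. T (X m \<omega>)) = 0"
  shows "mean (\<lambda>\<omega>. f (\<lambda>i. X i \<omega>) * (a - b * K\<^sup>2 - b * (w (\<lambda>i. X i \<omega>))\<^sup>2))
    \<le> mean (\<lambda>\<omega>. f (\<lambda>i. X i \<omega>) * (a - b * (w (\<lambda>i. X i \<omega>) + T (X m \<omega>))\<^sup>2))"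
proof -
  define g where "g x = f x * (a - b * (w x + T (x m))\<^sup>2)" for x
  have g: "g \<in> BLip (Suc m)"
    unfolding g_def
    by (intro BLip_mult BLip_diff BLip_const BLip_power2 BLip_add BLip_coordinate
        BLip_mono[OF f(1)] BLip_mono[OF w] T) auto
  have low: "(\<lambda>x. f x * (a - b * K\<^sup>2 - b * (w x)\<^sup>2)) \<in> BLip m"
    using f w by (intro BLip_mult BLip_diff BLip_const BLip_power2)
  have "f x * (a - b * K\<^sup>2 - b * (w x)\<^sup>2) \<le> section_mean m g x" for x
  proof -
    define c where "c = f x * (a - b * K\<^sup>2 - b * (w x)\<^sup>2)"
    define d where "d = - 2 * f x * b * w x"
    have sec: "g (vjoin m x (\<lambda>_. y)) = f x * (a - b * (w x + T y)\<^sup>2)" for y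
    proof -
      have "f (vjoin m x (\<lambda>_. y)) = f x" "w (vjoin m x (\<lambda>_. y)) = w x"
        by (rule BLip_cong[OF f(1)] BLip_cong[OF w]; simp add: vjoin_def)+
      then show ?thesis by (simp add: g_def vjoin_def)
    qed
    \<comment> \<open>Expanding the square and bounding \<open>(T y)\<^sup>2\<close> by
      \<open>K\<^sup>2\<close> leaves a minorant that is affine in \<open>T y\<close>, with a slope
      \<open>d\<close> of arbitrary sign.\<close>
    have pt: "d * T y + c \<le> g (vjoin m x (\<lambda>_. y))" for y
    proof -
      have "(T y)\<^sup>2 \<le> K\<^sup>2" using power_mono[OF T(2)[of y], of 2] by simp
      then have "f x * b * (T y)\<^sup>2 \<le> f x * b * K\<^sup>2" using f(2)[of x] b by (intro mult_left_mono) auto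
      then show ?thesis unfolding sec c_def d_def by (simp add: power2_eq_square algebra_simps)
    qed
    have fin: "(\<lambda>\<omega>. d * T (X m \<omega>)) \<in> Fin"
      by (intro Fin_cmult BLip_real_in_Fin T)
    have "c \<le> mean (\<lambda>\<omega>. d * T (X m \<omega>)) + c"
      using mean_mult_centered_nonneg[OF T(1,3)] by simp
    also have "\<dots> = mean (\<lambda>\<omega>. d * T (X m \<omega>) + c)" by (rule mean_add_const[OF fin, symmetric])
    also have "\<dots> \<le> section_mean m g x" unfolding section_mean_def
      by (intro mean_mono Fin_add fin Fin_const section_in_Fin g pt)
    finally show ?thesis unfolding c_def .
  qed
  then have "mean (\<lambda>\<omega>. f (\<lambda>i. X i \<omega>) * (a - b * K\<^sup>2 - b * (w (\<lambda>i. X i \<omega>))\<^sup>2))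
    \<le> mean (\<lambda>\<omega>. section_mean m g (\<lambda>i. X i \<omega>))"
    by (intro mean_mono BLip_in_Fin[OF low] BLip_in_Fin[OF section_mean_BLip[OF g]])
  also have "\<dots> = mean (\<lambda>\<omega>. g (\<lambda>i. X i \<omega>))" by (rule mean_eq_section_mean[OF g, symmetric])
  finally show ?thesis by (simp add: g_def)
qed

text \<open>The summands are removed starting from the last. Each costs
  \<open>b * K\<^sup>2\<close>, charged to \<open>a\<close>, so \<open>a\<close> varies in the
  induction; the hypothesis on \<open>a\<close> leaves it nonnegative at the end, where homogeneity
  is used.\<close>

lemma mean_square_block:
  assumes f: "f \<in> BLip m" "\<And>x. 0 \<le> f x" and b: "0 \<le> b" and a: "real n * b * K\<^sup>2 \<le> a"
    and T: "BLip_real T" "\<And>y. \<bar>T y\<bar> \<le> K" "mean (\<lambda>\<omega>. T (X 0 \<omega>)) = 0"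
  shows "(a - real n * b * K\<^sup>2) * mean (\<lambda>\<omega>. f (\<lambda>i. X i \<omega>))
    \<le> mean (\<lambda>\<omega>. f (\<lambda>i. X i \<omega>) * (a - b * (\<Sum>i=m..<m+n. T (X i \<omega>))\<^sup>2))"
  using a
proof (induction n arbitrary: a)
  case 0
  have "mean (\<lambda>\<omega>. a * f (\<lambda>i. X i \<omega>)) = a * mean (\<lambda>\<omega>. f (\<lambda>i. X i \<omega>))"
    using 0 by (intro mean_cmult BLip_in_Fin[OF f(1)]) auto
  then show ?case by (simp add: mult.commute)
next
  case (Suc n)
  define w where "w x = (\<Sum>i=m..<m+n. T (x i))" for x
  have w: "w \<in> BLip (m + n)" unfolding w_def by (intro BLip_sum BLip_coordinate T) auto
  have "(a - b * K\<^sup>2 - real n * b * K\<^sup>2) * mean (\<lambda>\<omega>. f (\<lambda>i. X i \<omega>))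
    \<le> mean (\<lambda>\<omega>. f (\<lambda>i. X i \<omega>) * (a - b * K\<^sup>2 - b * (w (\<lambda>i. X i \<omega>))\<^sup>2))"
    unfolding w_def using Suc.prems by (intro Suc.IH) (simp add: algebra_simps)
  also have "\<dots> \<le> mean (\<lambda>\<omega>. f (\<lambda>i. X i \<omega>) * (a - b * (w (\<lambda>i. X i \<omega>) + T (X (m + n) \<omega>))\<^sup>2))"
    by (intro mean_square_step w b f T BLip_mono[OF f(1)])
      (simp_all only: le_add1 mean_ident[OF T(1), of "m + n"] T(3))
  finally show ?case by (simp add: w_def algebra_simps)
qed

text \<open>The positive part of the Chebyshev minorant for the event that the block average of
  \<open>T\<close> has modulus below \<open>\<epsilon>\<close>: a Lipschitz replacement of its
  indicator.\<close>

definition block_bump :: "(real \<Rightarrow> real) \<Rightarrow> real \<Rightarrow> nat \<Rightarrow> nat \<Rightarrow> (nat \<Rightarrow> real) \<Rightarrow> real" where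
  "block_bump T \<epsilon> m n x = max 0 (1 - ((\<Sum>i=m..<m+n. T (x i)) / (real n * \<epsilon>))\<^sup>2)"

lemma block_bump_BLip:
  assumes "BLip_real T" shows "block_bump T \<epsilon> m n \<in> BLip (m + n)"
  unfolding block_bump_def
proof (rule BLip_contraction[where h = "max 0"])
  have "(\<lambda>x. (1 / (real n * \<epsilon>)) * (\<Sum>i=m..<m+n. T (x i))) \<in> BLip (m + n)"
    by (intro BLip_cmult BLip_sum BLip_coordinate assms) auto
  then show "(\<lambda>x. 1 - ((\<Sum>i=m..<m+n. T (x i)) / (real n * \<epsilon>))\<^sup>2) \<in> BLip (m + n)"
    by (intro BLip_diff BLip_const BLip_power2) (simp add: divide_simps)
qed auto

lemma block_bump_bounds: "0 \<le> block_bump T \<epsilon> m n x" "block_bump T \<epsilon> m n x \<le> 1"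
  by (auto simp: block_bump_def)

lemma block_bump_pos:
  assumes "0 < block_bump T \<epsilon> m n x" "0 < \<epsilon>" "0 < n"
  shows "\<bar>\<Sum>i=m..<m+n. T (x i)\<bar> < real n * \<epsilon>"
proof -
  have "((\<Sum>i=m..<m+n. T (x i)) / (real n * \<epsilon>))\<^sup>2 < 1\<^sup>2"
    using assms(1) by (auto simp: block_bump_def max_def split: if_splits)
  then have "\<bar>(\<Sum>i=m..<m+n. T (x i)) / (real n * \<epsilon>)\<bar> < 1"
    by (metis abs_square_less_1 power_one)
  then show ?thesis using assms by (simp add: abs_mult)
qed

text \<open>Chebyshev's inequality with a weight \<open>f\<close> that depends on earlier variables.
  With \<open>b = 1 / (n \<epsilon>)^2\<close> the total cost \<open>n * b * K\<^sup>2\<close> of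
  the block is \<open>K\<^sup>2 / (n * \<epsilon>\<^sup>2)\<close>.\<close>

lemma mean_block_bump:
  assumes f: "f \<in> BLip m" "\<And>x. 0 \<le> f x" and n: "0 < \<epsilon>" "0 < n" "K\<^sup>2 \<le> real n * \<epsilon>\<^sup>2"
    and T: "BLip_real T" "\<And>y. \<bar>T y\<bar> \<le> K" "mean (\<lambda>\<omega>. T (X 0 \<omega>)) = 0"
  shows "(1 - K\<^sup>2 / (real n * \<epsilon>\<^sup>2)) * mean (\<lambda>\<omega>. f (\<lambda>i. X i \<omega>))
    \<le> mean (\<lambda>\<omega>. f (\<lambda>i. X i \<omega>) * block_bump T \<epsilon> m n (\<lambda>i. X i \<omega>))"
proof -
  define b where "b = 1 / (real n * \<epsilon>)\<^sup>2"
  have nb: "real n * b * K\<^sup>2 = K\<^sup>2 / (real n * \<epsilon>\<^sup>2)"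
    using n by (simp add: b_def power2_eq_square field_simps)
  have fm: "f \<in> BLip (m + n)" using f(1) by (rule BLip_mono) simp
  have quad: "(\<lambda>x. f x * (1 - b * (\<Sum>i=m..<m+n. T (x i))\<^sup>2)) \<in> BLip (m + n)"
    by (intro BLip_mult BLip_diff BLip_const BLip_power2 BLip_sum BLip_coordinate T fm) auto
  have bump: "(\<lambda>x. f x * block_bump T \<epsilon> m n x) \<in> BLip (m + n)"
    by (intro BLip_mult fm block_bump_BLip T)
  have "(1 - real n * b * K\<^sup>2) * mean (\<lambda>\<omega>. f (\<lambda>i. X i \<omega>))
    \<le> mean (\<lambda>\<omega>. f (\<lambda>i. X i \<omega>) * (1 - b * (\<Sum>i=m..<m+n. T (X i \<omega>))\<^sup>2))"
  proof (rule mean_square_block[OF f _ _ T])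
    show "0 \<le> b" by (simp add: b_def)
    show "real n * b * K\<^sup>2 \<le> 1" unfolding nb using n by (simp add: divide_le_eq)
  qed
  also have "\<dots> \<le> mean (\<lambda>\<omega>. f (\<lambda>i. X i \<omega>) * block_bump T \<epsilon> m n (\<lambda>i. X i \<omega>))"
  proof (rule mean_mono[OF BLip_in_Fin[OF quad] BLip_in_Fin[OF bump]])
    show "f (\<lambda>i. X i \<omega>) * (1 - b * (\<Sum>i=m..<m+n. T (X i \<omega>))\<^sup>2)
      \<le> f (\<lambda>i. X i \<omega>) * block_bump T \<epsilon> m n (\<lambda>i. X i \<omega>)" for \<omega>
      by (rule mult_left_mono[OF _ f(2)]) (simp add: block_bump_def b_def power_divide)
  qed
  finally show ?thesis by (simp only: nb)
qed

text \<open>Packages \<open>sigma_gen M X\<close> as a measure space, so that membership of events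
  can be shown by measurability of the coordinates.\<close>

definition gen_measure :: "'a measure" where
  "gen_measure = sigma (space M) (\<Union>i. {X i -` B \<inter> space M |B. B \<in> sets borel})"

lemma sets_gen_measure: "sets gen_measure = sigma_gen M X"
  unfolding gen_measure_def sigma_gen_def by (rule sets_measure_of) auto

lemma space_gen_measure: "space gen_measure = space M"
  unfolding gen_measure_def by (rule space_measure_of) auto

lemma measurable_gen_measure [measurable]: "X i \<in> borel_measurable gen_measure"
proof (rule measurableI)
  fix B :: "real set" assume "B \<in> sets borel"
  then show "X i -` B \<inter> space gen_measure \<in> sets gen_measure"
    unfolding sets_gen_measure sigma_gen_def space_gen_measure
    by (intro sigma_sets.Basic) blast
qed auto

lemma sigma_gen_subset: "sigma_gen M X \<subseteq> sets M"
  unfolding sigma_gen_def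
proof (rule sets.sigma_sets_subset, safe)
  fix i and B :: "real set" assume "B \<in> sets borel"
  moreover have "X i \<in> borel_measurable M" using X_in_H H_measurable by auto
  ultimately show "X i -` B \<inter> space M \<in> sets M" by (rule measurable_sets[rotated])
qed

end

subsection \<open>Consequences of a continuous capacity\<close>

locale iid_sequence_continuous_capacity = iid_sequence +
  fixes V :: "'a set \<Rightarrow> real"
  assumes capacity: "subadditive_capacity M V"
    and prop_C: "property_C M H E V"
    and continuous: "continuous_capacity_on (sigma_gen M X) V"
begin

text \<open>Property (C) also asks for a majorant of the indicator; the constant 1 is taken.\<close>

lemma mean_le_capacity:
  assumes "A \<in> sets M" "Z \<in> Fin" "\<And>\<omega>. \<omega> \<in> space M \<Longrightarrow> Z \<omega> \<le> indicator A \<omega>"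
  shows "mean Z \<le> V A"
proof -
  have "E Z \<le> ereal (V A)"
    using prop_C assms Fin_imp_H[OF assms(2)] H_const[of 1] unfolding property_C_def
    by (auto simp: indicator_def)
  then show ?thesis using E_eq_mean[OF assms(2)] by (metis ereal_less_eq(3))
qed

lemma V_decseq:
  "range A \<subseteq> sigma_gen M X \<Longrightarrow> decseq A \<Longrightarrow> (\<Inter>n. A n) = {} \<Longrightarrow> (\<lambda>n. V (A n)) \<longlonglongrightarrow> 0"
  using continuous capacity.empty[of M V] capacity
  unfolding continuous_capacity_on_def subadditive_capacity_def by metis

lemma mean_symmetric_real:
  assumes h: "BLip_real h"
  shows "mean (\<lambda>\<omega>. - h (X 0 \<omega>)) = - mean (\<lambda>\<omega>. h (X 0 \<omega>))"
proof (rule ccontr)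
  define d where "d = mean (\<lambda>\<omega>. h (X 0 \<omega>)) + mean (\<lambda>\<omega>. - h (X 0 \<omega>))"
  assume "mean (\<lambda>\<omega>. - h (X 0 \<omega>)) \<noteq> - mean (\<lambda>\<omega>. h (X 0 \<omega>))"
  with mean_uminus_ge[OF BLip_real_in_Fin[OF h, of 0]] have d: "d > 0" by (auto simp: d_def)
  \<comment> \<open>Half the gap: the open intervals of radius \<open>\<epsilon>\<close> about the
    two means are disjoint, so no block average lies in both.\<close>
  define \<epsilon> where "\<epsilon> = d / 2"
  have \<epsilon>: "\<epsilon> > 0" using d by (simp add: \<epsilon>_def)
  \<comment> \<open>\<open>U\<close> is \<open>h\<close> centered at its upper mean and
    \<open>- W\<close> is \<open>h\<close> centered at its lower mean. Both \<open>U\<close> and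
    \<open>W\<close> have upper mean 0, as \<open>mean_block_bump\<close> requires.\<close>
  define U where "U y = h y - mean (\<lambda>\<omega>. h (X 0 \<omega>))" for y
  define W where "W y = - h y - mean (\<lambda>\<omega>. - h (X 0 \<omega>))" for y
  have U: "BLip_real U" and W: "BLip_real W"
    unfolding U_def W_def by (intro BLip_real_diff BLip_real_uminus h BLip_real_const)+
  have U0: "mean (\<lambda>\<omega>. U (X 0 \<omega>)) = 0" and W0: "mean (\<lambda>\<omega>. W (X 0 \<omega>)) = 0"
    using mean_add_const[OF BLip_real_in_Fin[OF h], of 0 "- mean (\<lambda>\<omega>. h (X 0 \<omega>))"]
      mean_add_const[OF Fin_uminus[OF BLip_real_in_Fin[OF h]], of 0 "- mean (\<lambda>\<omega>. - h (X 0 \<omega>))"]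
    by (simp_all add: U_def W_def)
  have UW: "U y + W y = - 2 * \<epsilon>" for y by (simp add: U_def W_def \<epsilon>_def d_def)
  obtain B1 B2 where B: "\<And>y. \<bar>U y\<bar> \<le> B1" "\<And>y. \<bar>W y\<bar> \<le> B2"
    using BLip_real_bounded[OF U] BLip_real_bounded[OF W] by metis
  define K where "K = max B1 B2"
  have K: "\<bar>U y\<bar> \<le> K" "\<bar>W y\<bar> \<le> K" for y using B[of y] by (auto simp: K_def)
  \<comment> \<open>Chosen to make the Chebyshev loss of block \<open>j\<close> at most
    \<open>1 / (4 * 2 ^ j)\<close>; the added 1 keeps the length positive even for
    \<open>K = 0\<close>.\<close>
  define len where "len j = (nat \<lceil>4 * K\<^sup>2 / \<epsilon>\<^sup>2\<rceil> + 1) * 2 ^ j" for j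
  define st where "st k = (\<Sum>j<k. len j)" for k
  have st_Suc: "st (Suc k) = st k + len k" for k by (simp add: st_def)
  have len0: "len j > 0" for j by (simp add: len_def)
  have len: "K\<^sup>2 / (real (len j) * \<epsilon>\<^sup>2) \<le> 1 / (4 * 2 ^ j)" for j
  proof -
    have "4 * K\<^sup>2 / \<epsilon>\<^sup>2 \<le> real (nat \<lceil>4 * K\<^sup>2 / \<epsilon>\<^sup>2\<rceil> + 1)" by linarith
    then have "4 * K\<^sup>2 / \<epsilon>\<^sup>2 * 2 ^ j \<le> real (nat \<lceil>4 * K\<^sup>2 / \<epsilon>\<^sup>2\<rceil> + 1) * 2 ^ j"
      by (rule mult_right_mono) simp
    also have "\<dots> = real (len j)"
      by (simp only: len_def of_nat_mult of_nat_power of_nat_numeral)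
    finally have "4 * K\<^sup>2 / \<epsilon>\<^sup>2 * 2 ^ j \<le> real (len j)" .
    then have "4 * K\<^sup>2 * 2 ^ j \<le> real (len j) * \<epsilon>\<^sup>2" using \<epsilon> by (simp add: field_simps)
    then show ?thesis using \<epsilon> len0[of j] by (simp add: divide_simps mult.commute mult.left_commute)
  qed
  have len_K: "K\<^sup>2 \<le> real (len j) * \<epsilon>\<^sup>2" for j
  proof -
    have "K\<^sup>2 / (real (len j) * \<epsilon>\<^sup>2) \<le> 1"
      by (rule order_trans[OF len]) (simp add: divide_simps order_trans[OF one_le_power[of "2::real" j]])
    then show ?thesis using \<epsilon> len0[of j] by (simp add: divide_simps split: if_splits)
  qed
  define u where "u j = block_bump U \<epsilon> (st j) (len j)" for j
  define l where "l j = block_bump W \<epsilon> (st j) (len j)" for j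
  have u: "u j \<in> BLip (st (Suc j))" and l: "l j \<in> BLip (st (Suc j))" for j
    unfolding u_def l_def st_Suc by (rule block_bump_BLip[OF U] block_bump_BLip[OF W])+
  have u01: "0 \<le> u j x" "u j x \<le> 1" and l01: "0 \<le> l j x" "l j x \<le> 1" for j x
    unfolding u_def l_def by (rule block_bump_bounds)+
  define G where "G k x = (\<Prod>j<k. l j x)" for k x
  have G0: "0 \<le> G k x" for k x unfolding G_def by (intro prod_nonneg) (simp add: l01)
  have G: "G k \<in> BLip (st k)" for k
  proof (induction k)
    case 0
    then show ?case unfolding G_def by (simp add: BLip_const)
  next
    case (Suc k)
    have "G (Suc k) = (\<lambda>x. G k x * l k x)" by (auto simp: G_def)
    moreover have "G k \<in> BLip (st (Suc k))" by (rule BLip_mono[OF Suc]) (simp add: st_Suc)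
    ultimately show ?case using l by (auto intro: BLip_mult)
  qed
  \<comment> \<open>Stated for a general \<open>T\<close>, since the next block is steered by
    \<open>W\<close> when the product \<open>G\<close> is extended and by \<open>U\<close> in the
    final estimate.\<close>
  have step: "(1 - 1 / (4 * 2 ^ k)) * mean (\<lambda>\<omega>. G k (\<lambda>i. X i \<omega>))
      \<le> mean (\<lambda>\<omega>. G k (\<lambda>i. X i \<omega>) * block_bump T \<epsilon> (st k) (len k) (\<lambda>i. X i \<omega>))"
    if T: "BLip_real T" "\<And>y. \<bar>T y\<bar> \<le> K" "mean (\<lambda>\<omega>. T (X 0 \<omega>)) = 0" for k T
  proof -
    have "mean (\<lambda>_. 0) \<le> mean (\<lambda>\<omega>. G k (\<lambda>i. X i \<omega>))"
      by (intro mean_mono Fin_const BLip_in_Fin[OF G] G0)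
    then have "(1 - 1 / (4 * 2 ^ k)) * mean (\<lambda>\<omega>. G k (\<lambda>i. X i \<omega>))
      \<le> (1 - K\<^sup>2 / (real (len k) * \<epsilon>\<^sup>2)) * mean (\<lambda>\<omega>. G k (\<lambda>i. X i \<omega>))"
      using len[of k] by (intro mult_right_mono) simp_all
    also have "\<dots> \<le> mean (\<lambda>\<omega>. G k (\<lambda>i. X i \<omega>) * block_bump T \<epsilon> (st k) (len k) (\<lambda>i. X i \<omega>))"
      by (rule mean_block_bump[OF G G0 \<epsilon> len0 len_K T])
    finally show ?thesis .
  qed
  \<comment> \<open>An explicit minorant of the product of the factors
    \<open>1 - 1 / (4 * 2 ^ j)\<close> for \<open>j < k\<close>, reproduced by the recursion and
    always above 1/2.\<close>
  have mean_G: "1 / 2 + 1 / (2 * 2 ^ k) \<le> mean (\<lambda>\<omega>. G k (\<lambda>i. X i \<omega>))" for k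
  proof (induction k)
    case 0
    then show ?case by (simp add: G_def)
  next
    case (Suc k)
    define t :: real where "t = 1 / 2 ^ k"
    have t: "0 < t" "t \<le> 1" by (auto simp: t_def)
    \<comment> \<open>After expansion this is \<open>t * t \<le> t\<close>.\<close>
    have "1 / 2 + t / 4 \<le> (1 - t / 4) * (1 / 2 + t / 2)"
      using t mult_mono[of t 1 t t] by (simp add: field_simps)
    also have "\<dots> \<le> (1 - t / 4) * mean (\<lambda>\<omega>. G k (\<lambda>i. X i \<omega>))"
    proof (rule mult_left_mono)
      show "1 / 2 + t / 2 \<le> mean (\<lambda>\<omega>. G k (\<lambda>i. X i \<omega>))" using Suc by (simp add: t_def)
    qed (use t in simp)
    also have "\<dots> \<le> mean (\<lambda>\<omega>. G k (\<lambda>i. X i \<omega>) * l k (\<lambda>i. X i \<omega>))"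
      using step[OF W K(2) W0, of k] by (simp add: t_def l_def mult.commute[of 4])
    also have "\<dots> = mean (\<lambda>\<omega>. G (Suc k) (\<lambda>i. X i \<omega>))" by (simp add: G_def)
    finally show ?case by (simp add: t_def)
  qed
  \<comment> \<open>The quantifier \<open>\<exists>j\<ge>k\<close> makes the events decrease; with
    block \<open>k\<close> alone in that place they need not be nested.\<close>
  define A where "A k = {\<omega> \<in> space M. (\<forall>j<k. 0 < l j (\<lambda>i. X i \<omega>)) \<and> (\<exists>j\<ge>k. 0 < u j (\<lambda>i. X i \<omega>))}" for k
  have A_gen: "A k \<in> sigma_gen M X" for k
  proof -
    have [measurable]: "U \<in> borel_measurable borel" "W \<in> borel_measurable borel"
      using U W by (auto intro: BLip_real_measurable)
    have [measurable]: "(\<lambda>\<omega>. u j (\<lambda>i. X i \<omega>)) \<in> borel_measurable gen_measure"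
      "(\<lambda>\<omega>. l j (\<lambda>i. X i \<omega>)) \<in> borel_measurable gen_measure" for j
      unfolding u_def l_def block_bump_def by measurable
    have "{\<omega> \<in> space gen_measure. (\<forall>j<k. 0 < l j (\<lambda>i. X i \<omega>)) \<and> (\<exists>j\<ge>k. 0 < u j (\<lambda>i. X i \<omega>))}
      \<in> sets gen_measure" by measurable
    then show ?thesis by (simp add: A_def sets_gen_measure space_gen_measure)
  qed
  have "decseq A"
    unfolding A_def by (intro decseq_SucI) (auto simp: less_Suc_eq intro: Suc_leD)
  moreover have "(\<Inter>k. A k) = {}"
  proof (rule ccontr)
    assume "(\<Inter>k. A k) \<noteq> {}"
    then obtain \<omega> where \<omega>: "\<And>k. \<omega> \<in> A k" by auto
    \<comment> \<open>\<open>A 0\<close> supplies a block \<open>j\<close> near the upper mean, and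
      \<open>A (Suc j)\<close> puts the same block near the lower mean.\<close>
    obtain j where "0 < u j (\<lambda>i. X i \<omega>)" using \<omega>[of 0] by (auto simp: A_def)
    moreover have "0 < l j (\<lambda>i. X i \<omega>)" using \<omega>[of "Suc j"] by (auto simp: A_def)
    ultimately have
      "\<bar>\<Sum>i=st j..<st j + len j. U (X i \<omega>)\<bar> < real (len j) * \<epsilon>"
      "\<bar>\<Sum>i=st j..<st j + len j. W (X i \<omega>)\<bar> < real (len j) * \<epsilon>"
      unfolding u_def l_def using \<epsilon> len0 by (auto dest!: block_bump_pos)
    moreover have "(\<Sum>i=st j..<st j + len j. U (X i \<omega>)) + (\<Sum>i=st j..<st j + len j. W (X i \<omega>))
      = - 2 * (real (len j) * \<epsilon>)"
      by (simp add: sum.distrib[symmetric] UW)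
    ultimately show False by linarith
  qed
  ultimately have lim: "(\<lambda>k. V (A k)) \<longlonglongrightarrow> 0" using A_gen by (intro V_decseq) auto
  \<comment> \<open>The test function \<open>G k\<close> times \<open>u k\<close> is positive only
    on \<open>A k\<close>, with \<open>k\<close> itself as witness for the existential.\<close>
  have "1 / 2 \<le> V (A k)" for k
  proof -
    define t :: real where "t = 1 / 2 ^ k"
    have t: "0 < t" "t \<le> 1" by (auto simp: t_def)
    have "1 / 2 \<le> (1 - t / 4) * (1 / 2 + t / 2)"
      using t mult_mono[of t 1 t t] by (simp add: field_simps)
    also have "\<dots> \<le> (1 - t / 4) * mean (\<lambda>\<omega>. G k (\<lambda>i. X i \<omega>))"
    proof (rule mult_left_mono)
      show "1 / 2 + t / 2 \<le> mean (\<lambda>\<omega>. G k (\<lambda>i. X i \<omega>))" using mean_G[of k] by (simp add: t_def)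
    qed (use t in simp)
    also have "\<dots> \<le> mean (\<lambda>\<omega>. G k (\<lambda>i. X i \<omega>) * u k (\<lambda>i. X i \<omega>))"
      using step[OF U K(1) U0, of k] by (simp add: t_def u_def mult.commute[of 4])
    also have "\<dots> \<le> V (A k)"
    proof (rule mean_le_capacity)
      show "A k \<in> sets M" using A_gen sigma_gen_subset by auto
      have "G k \<in> BLip (st (Suc k))" by (rule BLip_mono[OF G]) (simp add: st_Suc)
      then show "(\<lambda>\<omega>. G k (\<lambda>i. X i \<omega>) * u k (\<lambda>i. X i \<omega>)) \<in> Fin"
        by (rule BLip_in_Fin[OF BLip_mult[OF _ u]])
      fix \<omega> assume \<omega>: "\<omega> \<in> space M"
      have G1: "G k (\<lambda>i. X i \<omega>) \<le> 1" unfolding G_def by (intro prod_le_1) (simp add: l01)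
      show "G k (\<lambda>i. X i \<omega>) * u k (\<lambda>i. X i \<omega>) \<le> indicator (A k) \<omega>"
      proof (cases "\<omega> \<in> A k")
        case True
        then show ?thesis using mult_le_one[OF G1 u01(1) u01(2)] by simp
      next
        case False
        then have "(\<exists>j<k. l j (\<lambda>i. X i \<omega>) = 0) \<or> u k (\<lambda>i. X i \<omega>) = 0"
          using \<omega> l01(1) u01(1) unfolding A_def by (force simp: less_le)
        then have "G k (\<lambda>i. X i \<omega>) * u k (\<lambda>i. X i \<omega>) = 0" by (auto simp: G_def)
        then show ?thesis using False by auto
      qed
    qed
    finally show ?thesis .
  qed
  then have "1 / 2 \<le> (0::real)" using lim by (intro LIMSEQ_le_const) auto
  then show False by simp
qed

text \<open>Sections in the last variable are functions of one variable, so negation commutes with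
  \<open>section_mean\<close>; \<open>mean_ident\<close> passes from \<open>X n\<close> to
  \<open>X 0\<close>.\<close>

lemma mean_symmetric_BLip:
  assumes "f \<in> BLip n"
  shows "mean (\<lambda>\<omega>. - f (\<lambda>i. X i \<omega>)) = - mean (\<lambda>\<omega>. f (\<lambda>i. X i \<omega>))"
  using assms
proof (induction n arbitrary: f)
  case 0
  have "f (\<lambda>i. X i \<omega>) = f (\<lambda>_. 0)" for \<omega> by (rule BLip_cong[OF 0]) simp
  then show ?case by simp
next
  case (Suc n)
  have *: "section_mean n (\<lambda>x. - f x) x = - section_mean n f x" for x
  proof -
    note h = BLip_section[OF Suc.prems, of x]
    show ?thesis
      using mean_symmetric_real[OF h] mean_ident[OF h, of n] mean_ident[OF BLip_real_uminus[OF h], of n]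
      by (simp add: section_mean_def)
  qed
  have "mean (\<lambda>\<omega>. - f (\<lambda>i. X i \<omega>)) = mean (\<lambda>\<omega>. - section_mean n f (\<lambda>i. X i \<omega>))"
    using mean_eq_section_mean[OF BLip_uminus[OF Suc.prems]] by (simp add: *)
  also have "\<dots> = - mean (\<lambda>\<omega>. section_mean n f (\<lambda>i. X i \<omega>))"
    by (rule Suc.IH[OF section_mean_BLip[OF Suc.prems]])
  also have "\<dots> = - mean (\<lambda>\<omega>. f (\<lambda>i. X i \<omega>))"
    by (simp add: mean_eq_section_mean[OF Suc.prems])
  finally show ?case .
qed

section \<open>Tightness and the passage from bounded Lipschitz functions to
  \<open>H_tilde\<close>\<close>

lemma vnorm_tight:
  "(\<lambda>k. V {\<omega> \<in> space M. real k < vnorm n (\<lambda>i. X i \<omega>)}) \<longlonglongrightarrow> 0"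
proof (rule V_decseq)
  have "{\<omega> \<in> space gen_measure. real k < vnorm n (\<lambda>i. X i \<omega>)} \<in> sets gen_measure" for k
    unfolding vnorm_def by measurable
  then show "range (\<lambda>k. {\<omega> \<in> space M. real k < vnorm n (\<lambda>i. X i \<omega>)}) \<subseteq> sigma_gen M X"
    by (auto simp: sets_gen_measure space_gen_measure)
  show "decseq (\<lambda>k. {\<omega> \<in> space M. real k < vnorm n (\<lambda>i. X i \<omega>)})"
    by (auto simp: decseq_def)
  show "(\<Inter>k. {\<omega> \<in> space M. real k < vnorm n (\<lambda>i. X i \<omega>)}) = {}"
  proof -
    have "\<exists>k. \<not> real k < vnorm n (\<lambda>i. X i \<omega>)" for \<omega>
      using real_arch_simple[of "vnorm n (\<lambda>i. X i \<omega>)"] by (auto simp: not_less)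
    then show ?thesis by blast
  qed
qed

text \<open>\<open>1 - cutoff n k\<close> vanishes on the ball of radius \<open>k\<close>, hence
  lies below the indicator whose capacity \<open>vnorm_tight\<close> controls.\<close>

lemma cutoff_tight:
  "(\<lambda>k. mean (\<lambda>\<omega>. 1 - cutoff n k (\<lambda>i. X i \<omega>))) \<longlonglongrightarrow> 0"
proof (rule tendsto_sandwich[OF _ _ tendsto_const vnorm_tight])
  have fin: "(\<lambda>\<omega>. 1 - cutoff n k (\<lambda>i. X i \<omega>)) \<in> Fin" for k
    by (rule BLip_in_Fin[OF BLip_diff[OF BLip_const cutoff_BLip]])
  have "0 \<le> mean (\<lambda>\<omega>. 1 - cutoff n k (\<lambda>i. X i \<omega>))" for k
    using mean_mono[OF Fin_const fin, of 0 k] cutoff_bounds[of n k] by simp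
  then show "\<forall>\<^sub>F k in sequentially. 0 \<le> mean (\<lambda>\<omega>. 1 - cutoff n k (\<lambda>i. X i \<omega>))" by simp
  have "{\<omega> \<in> space M. real k < vnorm n (\<lambda>i. X i \<omega>)} \<in> sets M" for k
  proof -
    have [measurable]: "X i \<in> borel_measurable M" for i using X_in_H H_measurable by auto
    show ?thesis unfolding vnorm_def by measurable
  qed
  then have "mean (\<lambda>\<omega>. 1 - cutoff n k (\<lambda>i. X i \<omega>)) \<le> V {\<omega> \<in> space M. real k < vnorm n (\<lambda>i. X i \<omega>)}" for k
    by (rule mean_le_capacity[OF _ fin]) (auto simp: indicator_def cutoff_def)
  then show "\<forall>\<^sub>F k in sequentially. mean (\<lambda>\<omega>. 1 - cutoff n k (\<lambda>i. X i \<omega>))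
    \<le> V {\<omega> \<in> space M. real k < vnorm n (\<lambda>i. X i \<omega>)}" by simp
qed

text \<open>A tail mean below 1 at one level \<open>c\<close> already gives membership in
  \<open>Fin\<close>, because the absolute value of \<open>Y\<close> is at most its tail plus
  \<open>c\<close>. The limit can then be taken in the reals.\<close>

lemma H_tilde_iff:
  "Y \<in> H_tilde E X \<longleftrightarrow> (\<exists>n\<ge>1. \<exists>\<phi>\<in>C_l_Lip n. Y = (\<lambda>\<omega>. \<phi> (\<lambda>i. X i \<omega>))) \<and> Y \<in> Fin \<and>
    ((\<lambda>c. mean (\<lambda>\<omega>. max (\<bar>Y \<omega>\<bar> - c) 0)) \<longlongrightarrow> 0) at_top"
    (is "_ \<longleftrightarrow> ?rep \<and> _ \<and> ?lim")
proof -
  have "?lim \<longleftrightarrow> ((\<lambda>c. E (\<lambda>\<omega>. max (\<bar>Y \<omega>\<bar> - c) 0)) \<longlongrightarrow> 0) at_top" if "Y \<in> Fin"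
  proof -
    have "E (\<lambda>\<omega>. max (\<bar>Y \<omega>\<bar> - c) 0) = ereal (mean (\<lambda>\<omega>. max (\<bar>Y \<omega>\<bar> - c) 0))" for c
      by (rule E_eq_mean[OF Fin_tail[OF that]])
    from ext[OF this] have "(\<lambda>c. E (\<lambda>\<omega>. max (\<bar>Y \<omega>\<bar> - c) 0)) = (\<lambda>c. ereal (mean (\<lambda>\<omega>. max (\<bar>Y \<omega>\<bar> - c) 0)))" .
    then have "((\<lambda>c. E (\<lambda>\<omega>. max (\<bar>Y \<omega>\<bar> - c) 0)) \<longlongrightarrow> 0) at_top
      \<longleftrightarrow> ((\<lambda>c. ereal (mean (\<lambda>\<omega>. max (\<bar>Y \<omega>\<bar> - c) 0))) \<longlongrightarrow> ereal 0) at_top"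
      unfolding zero_ereal_def by (rule arg_cong)
    then show ?thesis unfolding lim_ereal by (rule sym)
  qed
  moreover have "Y \<in> Fin"
    if Y: "Y \<in> H" and lim: "((\<lambda>c. E (\<lambda>\<omega>. max (\<bar>Y \<omega>\<bar> - c) 0)) \<longlongrightarrow> 0) at_top"
  proof -
    have "\<forall>\<^sub>F c in at_top. E (\<lambda>\<omega>. max (\<bar>Y \<omega>\<bar> - c) 0) < 1"
      using lim by (rule order_tendstoD) simp
    then obtain c where c: "E (\<lambda>\<omega>. max (\<bar>Y \<omega>\<bar> - c) 0) < 1"
      using eventually_happens by fastforce
    have "(\<lambda>\<omega>. max (\<bar>Y \<omega>\<bar> - c) 0) \<in> H" by (rule H_contraction[OF Y]) auto
    then have "(\<lambda>\<omega>. max (\<bar>Y \<omega>\<bar> - c) 0) \<in> Fin" using c by (auto simp: Fin_def)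
    from Fin_add[OF this Fin_const[of c]] show ?thesis
      by (rule Fin_dominated[OF Y]) auto
  qed
  moreover have "Y \<in> H" if ?rep using that C_l_Lip_in_H by blast
  ultimately show ?thesis unfolding H_tilde_def by blast
qed

lemma mean_symmetric:
  assumes "Y \<in> H_tilde E X"
  shows "mean (\<lambda>\<omega>. - Y \<omega>) = - mean Y"
proof (rule mean_symmetric_approx)
  obtain n \<phi> where \<phi>: "\<phi> \<in> C_l_Lip n" and Y: "Y = (\<lambda>\<omega>. \<phi> (\<lambda>i. X i \<omega>))" and fin: "Y \<in> Fin"
    and lim: "((\<lambda>c. mean (\<lambda>\<omega>. max (\<bar>Y \<omega>\<bar> - c) 0)) \<longlongrightarrow> 0) at_top"
    using assms unfolding H_tilde_iff by blast
  show "Y \<in> Fin" by (rule fin)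
  fix e :: real assume e: "0 < e"
  have "\<forall>\<^sub>F c in at_top. mean (\<lambda>\<omega>. max (\<bar>Y \<omega>\<bar> - c) 0) < e / 2 \<and> 0 < c"
    using order_tendstoD(2)[OF lim, of "e / 2"] e eventually_gt_at_top[of "0::real"]
    by (intro eventually_conj) auto
  then obtain c where c: "mean (\<lambda>\<omega>. max (\<bar>Y \<omega>\<bar> - c) 0) < e / 2" "0 < c"
    using eventually_happens by fastforce
  \<comment> \<open>\<open>k\<close> is chosen after \<open>c\<close>, since the cutoff error gets
    multiplied by the clipping level.\<close>
  have "\<forall>\<^sub>F k in sequentially. mean (\<lambda>\<omega>. 1 - cutoff n k (\<lambda>i. X i \<omega>)) < e / (2 * c)"
    using cutoff_tight e c by (intro order_tendstoD) auto
  then obtain k where k: "mean (\<lambda>\<omega>. 1 - cutoff n k (\<lambda>i. X i \<omega>)) < e / (2 * c)"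
    using eventually_happens by fastforce
  define f where "f x = max (- c) (min c (\<phi> x)) * cutoff n k x" for x
  have f: "f \<in> BLip n" unfolding f_def using \<phi> c by (intro clip_cutoff_BLip) auto
  have fin1: "(\<lambda>\<omega>. 1 - cutoff n k (\<lambda>i. X i \<omega>)) \<in> Fin"
    by (rule BLip_in_Fin[OF BLip_diff[OF BLip_const cutoff_BLip]])
  \<comment> \<open>The first summand is the exact clipping error, the second bounds the error of
    cutting off a function with values in the interval from \<open>- c\<close> to
    \<open>c\<close>.\<close>
  define R where "R \<omega> = max (\<bar>Y \<omega>\<bar> - c) 0 + c * (1 - cutoff n k (\<lambda>i. X i \<omega>))" for \<omega>
  show "\<exists>W R. W \<in> Fin \<and> R \<in> Fin \<and> mean (\<lambda>\<omega>. - W \<omega>) = - mean W \<and>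
    (\<forall>\<omega>\<in>space M. \<bar>Y \<omega> - W \<omega>\<bar> \<le> R \<omega>) \<and> mean R \<le> e"
  proof (intro exI conjI ballI)
    show "(\<lambda>\<omega>. f (\<lambda>i. X i \<omega>)) \<in> Fin" by (rule BLip_in_Fin[OF f])
    show "R \<in> Fin" unfolding R_def by (intro Fin_add Fin_tail fin Fin_cmult fin1)
    show "mean (\<lambda>\<omega>. - f (\<lambda>i. X i \<omega>)) = - mean (\<lambda>\<omega>. f (\<lambda>i. X i \<omega>))"
      by (rule mean_symmetric_BLip[OF f])
    have "mean R \<le> mean (\<lambda>\<omega>. max (\<bar>Y \<omega>\<bar> - c) 0) + mean (\<lambda>\<omega>. c * (1 - cutoff n k (\<lambda>i. X i \<omega>)))"
      unfolding R_def by (intro mean_add_le Fin_tail fin Fin_cmult fin1)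
    also have "mean (\<lambda>\<omega>. c * (1 - cutoff n k (\<lambda>i. X i \<omega>))) = c * mean (\<lambda>\<omega>. 1 - cutoff n k (\<lambda>i. X i \<omega>))"
      using c by (intro mean_cmult fin1) simp
    also have "\<dots> \<le> c * (e / (2 * c))" using k c by (intro mult_left_mono) auto
    also have "\<dots> = e / 2" using c by simp
    finally show "mean R \<le> e" using c by simp
    fix \<omega>
    define y where "y = max (- c) (min c (Y \<omega>))"
    define q where "q = cutoff n k (\<lambda>i. X i \<omega>)"
    have q: "q \<le> 1" unfolding q_def by (rule cutoff_bounds)
    have "\<bar>Y \<omega> - f (\<lambda>i. X i \<omega>)\<bar> = \<bar>(Y \<omega> - y) + y * (1 - q)\<bar>"
      by (simp add: f_def y_def q_def Y algebra_simps)
    also have "\<dots> \<le> \<bar>Y \<omega> - y\<bar> + \<bar>y\<bar> * (1 - q)"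
      using abs_triangle_ineq[of "Y \<omega> - y" "y * (1 - q)"] q by (simp add: abs_mult)
    also have "\<bar>Y \<omega> - y\<bar> = max (\<bar>Y \<omega>\<bar> - c) 0" using c by (auto simp: y_def max_def min_def)
    also have "\<bar>y\<bar> * (1 - q) \<le> c * (1 - q)"
      using q c by (intro mult_right_mono) (auto simp: y_def)
    finally show "\<bar>Y \<omega> - f (\<lambda>i. X i \<omega>)\<bar> \<le> R \<omega>" by (simp add: R_def q_def)
  qed
qed

section \<open>Linear structure of \<open>H_tilde\<close> and linearity of \<open>E\<close> on
  it\<close>

lemma H_tilde_zero: "(\<lambda>_. 0) \<in> H_tilde E X"
  unfolding H_tilde_iff
proof (intro conjI)
  show "\<exists>n\<ge>1. \<exists>\<phi>\<in>C_l_Lip n. (\<lambda>_. 0) = (\<lambda>\<omega>. \<phi> (\<lambda>i. X i \<omega>))"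
    using BLip_const[of 0 1] BLip_subset_C_l_Lip by (intro exI[of _ 1] conjI bexI[of _ "\<lambda>_. 0"]) auto
  have "\<forall>\<^sub>F c in at_top. mean (\<lambda>\<omega>. max (\<bar>0\<bar> - c) 0) = 0"
    using eventually_ge_at_top[of "0::real"] by eventually_elim simp
  then show "((\<lambda>c. mean (\<lambda>\<omega>. max (\<bar>0\<bar> - c) 0)) \<longlongrightarrow> 0) at_top" by (rule tendsto_eventually)
qed (rule Fin_const)

lemma tail_tendsto_zero:
  assumes "Y \<in> Fin" "\<And>c. mean (\<lambda>\<omega>. max (\<bar>Y \<omega>\<bar> - c) 0) \<le> g c" "(g \<longlongrightarrow> 0) at_top"
  shows "((\<lambda>c. mean (\<lambda>\<omega>. max (\<bar>Y \<omega>\<bar> - c) 0)) \<longlongrightarrow> 0) at_top"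
proof (rule tendsto_sandwich[OF _ _ tendsto_const assms(3)])
  have "mean (\<lambda>_. 0) \<le> mean (\<lambda>\<omega>. max (\<bar>Y \<omega>\<bar> - c) 0)" for c
    by (intro mean_mono Fin_const Fin_tail assms) simp
  then show "\<forall>\<^sub>F c in at_top. 0 \<le> mean (\<lambda>\<omega>. max (\<bar>Y \<omega>\<bar> - c) 0)" by simp
qed (simp add: assms)

lemma tail_scaled:
  fixes b :: real
  assumes "((\<lambda>c. mean (\<lambda>\<omega>. max (\<bar>Y \<omega>\<bar> - c) 0)) \<longlongrightarrow> 0) at_top" "0 < b"
  shows "((\<lambda>c. mean (\<lambda>\<omega>. max (\<bar>Y \<omega>\<bar> - c / b) 0)) \<longlongrightarrow> 0) at_top"
proof (rule filterlim_compose[OF assms(1)])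
  show "filterlim (\<lambda>c. c / b) at_top at_top"
    using filterlim_tendsto_pos_mult_at_top[OF tendsto_const _ filterlim_ident, of "1 / b"] assms(2) by simp
qed

text \<open>The level is split evenly: the tail of the sum above \<open>c\<close> is at most the sum
  of the two tails above \<open>c / 2\<close>.\<close>

lemma H_tilde_add:
  assumes "Y \<in> H_tilde E X" "Z \<in> H_tilde E X"
  shows "(\<lambda>\<omega>. Y \<omega> + Z \<omega>) \<in> H_tilde E X"
proof -
  obtain n \<phi> where \<phi>: "n \<ge> 1" "\<phi> \<in> C_l_Lip n" and Y: "Y = (\<lambda>\<omega>. \<phi> (\<lambda>i. X i \<omega>))" and finY: "Y \<in> Fin"
    and limY: "((\<lambda>c. mean (\<lambda>\<omega>. max (\<bar>Y \<omega>\<bar> - c) 0)) \<longlongrightarrow> 0) at_top"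
    using assms(1) unfolding H_tilde_iff by blast
  obtain k \<psi> where \<psi>: "k \<ge> 1" "\<psi> \<in> C_l_Lip k" and Z: "Z = (\<lambda>\<omega>. \<psi> (\<lambda>i. X i \<omega>))" and finZ: "Z \<in> Fin"
    and limZ: "((\<lambda>c. mean (\<lambda>\<omega>. max (\<bar>Z \<omega>\<bar> - c) 0)) \<longlongrightarrow> 0) at_top"
    using assms(2) unfolding H_tilde_iff by blast
  show ?thesis unfolding H_tilde_iff
  proof (intro conjI)
    have "(\<lambda>x. \<phi> x + \<psi> x) \<in> C_l_Lip (max n k)"
      by (intro C_l_Lip_add C_l_Lip_mono[OF \<phi>(2)] C_l_Lip_mono[OF \<psi>(2)]) auto
    then show "\<exists>n\<ge>1. \<exists>\<theta>\<in>C_l_Lip n. (\<lambda>\<omega>. Y \<omega> + Z \<omega>) = (\<lambda>\<omega>. \<theta> (\<lambda>i. X i \<omega>))"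
      unfolding Y Z using \<phi>(1) by (intro exI[of _ "max n k"] conjI bexI) auto
    show fin: "(\<lambda>\<omega>. Y \<omega> + Z \<omega>) \<in> Fin" using finY finZ by (rule Fin_add)
    show "((\<lambda>c. mean (\<lambda>\<omega>. max (\<bar>Y \<omega> + Z \<omega>\<bar> - c) 0)) \<longlongrightarrow> 0) at_top"
    proof (rule tail_tendsto_zero[OF fin])
      show "mean (\<lambda>\<omega>. max (\<bar>Y \<omega> + Z \<omega>\<bar> - c) 0)
        \<le> mean (\<lambda>\<omega>. max (\<bar>Y \<omega>\<bar> - c / 2) 0) + mean (\<lambda>\<omega>. max (\<bar>Z \<omega>\<bar> - c / 2) 0)" for c
      proof -
        have "max (\<bar>Y \<omega> + Z \<omega>\<bar> - c) 0 \<le> max (\<bar>Y \<omega>\<bar> - c / 2) 0 + max (\<bar>Z \<omega>\<bar> - c / 2) 0" for \<omega>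
          by linarith
        then have "mean (\<lambda>\<omega>. max (\<bar>Y \<omega> + Z \<omega>\<bar> - c) 0)
          \<le> mean (\<lambda>\<omega>. max (\<bar>Y \<omega>\<bar> - c / 2) 0 + max (\<bar>Z \<omega>\<bar> - c / 2) 0)"
          by (intro mean_mono Fin_add Fin_tail fin finY finZ)
        also have "\<dots> \<le> mean (\<lambda>\<omega>. max (\<bar>Y \<omega>\<bar> - c / 2) 0) + mean (\<lambda>\<omega>. max (\<bar>Z \<omega>\<bar> - c / 2) 0)"
          by (intro mean_add_le Fin_tail finY finZ)
        finally show ?thesis .
      qed
      show "((\<lambda>c. mean (\<lambda>\<omega>. max (\<bar>Y \<omega>\<bar> - c / 2) 0) + mean (\<lambda>\<omega>. max (\<bar>Z \<omega>\<bar> - c / 2) 0)) \<longlongrightarrow> 0) at_top"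
        using tendsto_add[OF tail_scaled[OF limY, of 2] tail_scaled[OF limZ, of 2]] by simp
    qed
  qed
qed

lemma H_tilde_cmult:
  assumes "Y \<in> H_tilde E X"
  shows "(\<lambda>\<omega>. a * Y \<omega>) \<in> H_tilde E X"
proof -
  obtain n \<phi> where \<phi>: "n \<ge> 1" "\<phi> \<in> C_l_Lip n" and Y: "Y = (\<lambda>\<omega>. \<phi> (\<lambda>i. X i \<omega>))" and finY: "Y \<in> Fin"
    and limY: "((\<lambda>c. mean (\<lambda>\<omega>. max (\<bar>Y \<omega>\<bar> - c) 0)) \<longlongrightarrow> 0) at_top"
    using assms unfolding H_tilde_iff by blast
  \<comment> \<open>Adding 1 keeps the scale positive for \<open>a = 0\<close>, so that the level
    \<open>c / b\<close> makes sense and still tends to infinity.\<close>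
  define b where "b = \<bar>a\<bar> + 1"
  have b: "0 < b" by (simp add: b_def)
  show ?thesis unfolding H_tilde_iff
  proof (intro conjI)
    show "\<exists>n\<ge>1. \<exists>\<theta>\<in>C_l_Lip n. (\<lambda>\<omega>. a * Y \<omega>) = (\<lambda>\<omega>. \<theta> (\<lambda>i. X i \<omega>))"
      unfolding Y using \<phi>(1) C_l_Lip_cmult[OF \<phi>(2), of a] by (intro exI[of _ n] conjI bexI) auto
    show fin: "(\<lambda>\<omega>. a * Y \<omega>) \<in> Fin" using finY by (rule Fin_cmult)
    show "((\<lambda>c. mean (\<lambda>\<omega>. max (\<bar>a * Y \<omega>\<bar> - c) 0)) \<longlongrightarrow> 0) at_top"
    proof (rule tail_tendsto_zero[OF fin])
      show "mean (\<lambda>\<omega>. max (\<bar>a * Y \<omega>\<bar> - c) 0) \<le> b * mean (\<lambda>\<omega>. max (\<bar>Y \<omega>\<bar> - c / b) 0)" for c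
      proof -
        have "max (\<bar>a * Y \<omega>\<bar> - c) 0 \<le> b * max (\<bar>Y \<omega>\<bar> - c / b) 0" for \<omega>
        proof -
          have "\<bar>a * Y \<omega>\<bar> - c \<le> b * (\<bar>Y \<omega>\<bar> - c / b)"
            using b unfolding right_diff_distrib by (simp add: abs_mult) (simp add: b_def distrib_right)
          also have "\<dots> \<le> b * max (\<bar>Y \<omega>\<bar> - c / b) 0" using b by (intro mult_left_mono) auto
          finally show ?thesis using b by simp
        qed
        then have "mean (\<lambda>\<omega>. max (\<bar>a * Y \<omega>\<bar> - c) 0) \<le> mean (\<lambda>\<omega>. b * max (\<bar>Y \<omega>\<bar> - c / b) 0)"
          by (intro mean_mono Fin_cmult Fin_tail fin finY)
        also have "\<dots> = b * mean (\<lambda>\<omega>. max (\<bar>Y \<omega>\<bar> - c / b) 0)"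
          using b by (intro mean_cmult Fin_tail finY) simp
        finally show ?thesis .
      qed
      show "((\<lambda>c. b * mean (\<lambda>\<omega>. max (\<bar>Y \<omega>\<bar> - c / b) 0)) \<longlongrightarrow> 0) at_top"
        using tendsto_mult_right_zero[OF tail_scaled[OF limY b]] .
    qed
  qed
qed

lemma H_tilde_subset_Fin: "H_tilde E X \<subseteq> Fin"
  by (auto simp: H_tilde_iff)

text \<open>Subadditivity for the negatives becomes superadditivity once the mean commutes with
  negation.\<close>

lemma mean_add:
  assumes Y: "Y \<in> H_tilde E X" and Z: "Z \<in> H_tilde E X"
  shows "mean (\<lambda>\<omega>. Y \<omega> + Z \<omega>) = mean Y + mean Z"
proof (rule antisym)
  have fin: "Y \<in> Fin" "Z \<in> Fin" using assms H_tilde_subset_Fin by auto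
  show "mean (\<lambda>\<omega>. Y \<omega> + Z \<omega>) \<le> mean Y + mean Z" by (rule mean_add_le[OF fin])
  have "mean (\<lambda>\<omega>. - (Y \<omega> + Z \<omega>)) \<le> mean (\<lambda>\<omega>. - Y \<omega>) + mean (\<lambda>\<omega>. - Z \<omega>)"
    using mean_add_le[OF Fin_uminus[OF fin(1)] Fin_uminus[OF fin(2)]] by (simp add: algebra_simps)
  then show "mean Y + mean Z \<le> mean (\<lambda>\<omega>. Y \<omega> + Z \<omega>)"
    by (simp only: mean_symmetric[OF H_tilde_add[OF assms]] mean_symmetric[OF Y] mean_symmetric[OF Z])
qed

lemma mean_cmult_H_tilde:
  assumes Y: "Y \<in> H_tilde E X"
  shows "mean (\<lambda>\<omega>. a * Y \<omega>) = a * mean Y"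
proof (cases "0 \<le> a")
  case True
  then show ?thesis using mean_cmult H_tilde_subset_Fin Y by blast
next
  case False
  have "mean (\<lambda>\<omega>. (- a) * - Y \<omega>) = (- a) * mean (\<lambda>\<omega>. - Y \<omega>)"
    using False H_tilde_subset_Fin Y by (intro mean_cmult Fin_uminus) auto
  then show ?thesis by (simp add: mean_symmetric[OF Y])
qed

theorem linear_on_H_tilde: "linear_functional_on (H_tilde E X) E"
  unfolding linear_functional_on_def linear_space_def
proof (intro conjI ballI allI)
  have real: "E Y = ereal (mean Y)" if "Y \<in> H_tilde E X" for Y
    using that H_tilde_subset_Fin by (intro E_eq_mean) auto
  fix Y assume Y: "Y \<in> H_tilde E X"
  show "\<bar>E Y\<bar> \<noteq> \<infinity>" by (subst real[OF Y]) simp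
  show "E (\<lambda>\<omega>. c * Y \<omega>) = ereal c * E Y" for c
    using real[OF H_tilde_cmult[OF Y, of c]] real[OF Y] mean_cmult_H_tilde[OF Y, of c]
    by (metis times_ereal.simps(1))
  fix Z assume Z: "Z \<in> H_tilde E X"
  show "E (\<lambda>\<omega>. Y \<omega> + Z \<omega>) = E Y + E Z"
    using real[OF H_tilde_add[OF Y Z]] real[OF Y] real[OF Z] mean_add[OF Y Z]
    by (metis plus_ereal.simps(1))
qed (auto intro: H_tilde_zero H_tilde_add H_tilde_cmult)

end

theorem proposition4p1:
  fixes M :: "'a measure"
    and H :: "('a \<Rightarrow> real) set"
    and E :: "('a \<Rightarrow> real) \<Rightarrow> ereal"
    and X :: "nat \<Rightarrow> 'a \<Rightarrow> real"
    and V :: "'a set \<Rightarrow> real"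
  assumes "sublinear_expectation_space M H E"
    and "\<And>i. X i \<in> H"
    and "independent_seq H E X"
    and "identically_distributed E X"
    and "subadditive_capacity M V"
    and "property_C M H E V"
    and "continuous_capacity_on (sigma_gen M X) V"
  shows "linear_functional_on (H_tilde E X) E"
proof -
  interpret iid_sequence_continuous_capacity M H E X V
    using assms
    by (intro iid_sequence_continuous_capacity.intro iid_sequence.intro iid_sequence_axioms.intro
        iid_sequence_continuous_capacity_axioms.intro)
  show ?thesis by (rule linear_on_H_tilde)
qed

end
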